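(* Every finite simple graph $G$ on $n\ge 9$ vertices with at least $5n-14$ edges has a $\mathcal{K}_9^{-6}$ minor, i.e. $G$ has an $H$ minor for some graph $H$ obtained from $K_9$ by deleting exactly $6$ edges.
   Context: All graphs are finite, undirected, without loops or parallel edges. A graph $H$ is a minor of $G$ if $H$ can be obtained from a subgraph of $G$ by contracting edges. For positive integers $t,s$, $\mathcal{K}_t^{-s}$ denotes the family of all graphs obtained from $K_t$ by deleting $s$ edges; $G$ has a $\mathcal{K}_t^{-s}$ minor if it has an $H$ minor for some $H\in\mathcal{K}_t^{-s}$. *)

theory Defs
  imports "Graph_Theory.Graph_Theory"
begin

text \<open>
  As in the session Graph_Theory, a finite simple graph is a symmetric loop-free digraph whose arcs
  are pairs of vertices (\<open>pair_graph\<close>), so an undirected edge is a pair of opposite arcs.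
  \<open>uedges\<close> is the set of undirected edges, each as a two-element set of vertices; edges are counted
  and deleted through it, since counting \<open>parcs\<close> would count each edge twice.
\<close>

definition uedges :: "'a pair_pre_digraph \<Rightarrow> 'a set set" where
  "uedges G = {{u, v} | u v. (u, v) \<in> parcs G}"

definition delete_uedges :: "'a pair_pre_digraph \<Rightarrow> 'a set set \<Rightarrow> 'a pair_pre_digraph" where
  "delete_uedges G F = \<lparr> pverts = pverts G, parcs = {(u, v) \<in> parcs G. {u, v} \<notin> F} \<rparr>"

text \<open>
  Contracting the edge \<open>uv\<close>: the merged vertex keeps the name \<open>u\<close>, the loop that arises is
  dropped, and parallel edges coincide because arcs form a set.
\<close>

definition contract_uedge :: "'a pair_pre_digraph \<Rightarrow> 'a \<Rightarrow> 'a \<Rightarrow> 'a pair_pre_digraph" where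
  "contract_uedge G u v =
    (let m = (\<lambda>x. if x = v then u else x)
     in \<lparr> pverts = m ` pverts G, parcs = {(m x, m y) | x y. (x, y) \<in> parcs G \<and> m x \<noteq> m y} \<rparr>)"

inductive contracts_to :: "'a pair_pre_digraph \<Rightarrow> 'a pair_pre_digraph \<Rightarrow> bool" where
  refl: "contracts_to G G"
| step: "contracts_to G M \<Longrightarrow> (u, v) \<in> parcs M \<Longrightarrow> contracts_to G (contract_uedge M u v)"

text \<open>
  \<open>subgraph\<close> alone also admits subdigraphs containing only one of two opposite arcs, hence the
  requirement \<open>pair_graph S\<close>.
\<close>

definition has_minor :: "'a pair_pre_digraph \<Rightarrow> 'b pair_pre_digraph \<Rightarrow> bool" where
  "has_minor G H \<longleftrightarrow>
    (\<exists>S M. pair_graph S \<and> subgraph (with_proj S) (with_proj G) \<and> contracts_to S M \<and>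
      digraph_iso (with_proj M) (with_proj H))"

text \<open>
  The members of the family have vertices in \<open>nat\<close>, which represents every isomorphism
  type of finite graphs; \<open>has_minor\<close> depends only on the isomorphism type of its second argument.
\<close>

definition K_minus :: "nat \<Rightarrow> nat \<Rightarrow> nat pair_pre_digraph set" where
  "K_minus t s = {delete_uedges K F | K F.
     complete_digraph t (with_proj K) \<and> F \<subseteq> uedges K \<and> card F = s}"

definition has_K_minus_minor :: "'a pair_pre_digraph \<Rightarrow> nat \<Rightarrow> nat \<Rightarrow> bool" where
  "has_K_minus_minor G t s \<longleftrightarrow> (\<exists>H \<in> K_minus t s. has_minor G H)"

lemma pair_graph_iff:
  "pair_graph G \<longleftrightarrow> finite (pverts G) \<and> parcs G \<subseteq> pverts G \<times> pverts G \<and> sym (parcs G) \<and>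
     irrefl (parcs G)" (is "_ \<longleftrightarrow> ?R")
proof
  assume "pair_graph G"
  then interpret pair_graph G .
  show ?R
    using pair_finite_verts pair_sym_arcs arc_fst_in_verts arc_snd_in_verts pair_no_loops
    by (fastforce simp: symmetric_def irrefl_def)
next
  assume R: ?R
  then have "finite (parcs G)"
    by (meson finite_SigmaI finite_subset)
  with R show "pair_graph G"
    by unfold_locales (auto simp: symmetric_def irrefl_def)
qed

lemma pair_graph_contract_uedge:
  assumes "pair_graph G"
  shows "pair_graph (contract_uedge G u v)"
  using assms unfolding pair_graph_iff contract_uedge_def Let_def sym_def irrefl_def
  by (auto; blast)

lemma pair_graph_contracts_to:
  assumes "contracts_to G M" "pair_graph G"
  shows "pair_graph M"
  using assms by induction (auto intro: pair_graph_contract_uedge)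

lemma card_parcs_eq_twice_card_uedges:
  assumes "pair_graph G"
  shows "card (parcs G) = 2 * card (uedges G)"
proof -
  have G: "finite (parcs G)" "sym (parcs G)" "irrefl (parcs G)"
    using assms unfolding pair_graph_iff by (auto intro: finite_subset)
  have eq: "uedges G = (\<lambda>(u, v). {u, v}) ` parcs G"
    by (auto simp: uedges_def image_iff)
  have "card {a \<in> parcs G. (\<lambda>(u, v). {u, v}) a = e} = 2" if "e \<in> uedges G" for e
  proof -
    from that obtain u v where e: "e = {u, v}" and uv: "(u, v) \<in> parcs G"
      by (auto simp: uedges_def)
    have "u \<noteq> v" using uv G(3) by (auto simp: irrefl_def)
    moreover have "{a \<in> parcs G. (\<lambda>(u, v). {u, v}) a = e} = {(u, v), (v, u)}"
      using uv G(2) e by (auto simp: doubleton_eq_iff dest: symD)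
    ultimately show ?thesis by simp
  qed
  then have "(\<Sum>e \<in> uedges G. card {a \<in> parcs G. (\<lambda>(u, v). {u, v}) a = e}) = 2 * card (uedges G)"
    by simp
  moreover have "card (parcs G) =
      (\<Sum>e \<in> uedges G. card {a \<in> parcs G. (\<lambda>(u, v). {u, v}) a = e})"
    using G(1) sum.image_gen[of "parcs G" "\<lambda>_. 1::nat" "\<lambda>(u, v). {u, v}"] by (simp add: eq)
  ultimately show ?thesis by simp
qed

end

theory Submission
  imports Defs
begin

text \<open>
  Let \<open>G\<close> be a counterexample on a minimum number \<open>n\<close> of vertices, with exactly \<open>5n - 14\<close> edges.
  Contracting an edge shows that every edge lies in at least 5 triangles, so all degrees are at
  least 6 and some are at most 9. If \<open>7 \<le> d(v) \<le> 9\<close> and \<open>C\<close> is a component of \<open>G - N[v]\<close> that is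
  adjacent to every vertex of \<open>N(v)\<close> having a non-neighbour in \<open>N(v)\<close>, then contracting \<open>C\<close> next to
  the dense graph \<open>N[v]\<close> gives 30 edges on 9 vertices. A vertex of degree 6 has a complete
  neighbourhood; counting edges across separations shows that two non-adjacent such vertices are
  joined by 4 disjoint paths between their closed neighbourhoods, which again gives the minor.
  Finally choose \<open>x\<close> with \<open>d(x) \<le> 9\<close> and a component \<open>K\<close> of \<open>G - N[x]\<close> without vertices of degree 6 such
  that \<open>|K|\<close> is minimum. Edge counting yields a vertex of degree at most 9 in \<open>K\<close>; for \<open>w \<in> K\<close> of least
  degree, the component of \<open>G - N[w]\<close> containing \<open>x\<close> is as in the first case, a contradiction.
\<close>

section \<open>Minors as systems of connected bags\<close>

text \<open>Relations count arcs, so edge numbers are doubled: 30 = 36 - 6 edges appear as 60, and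
  5n - 14 as 10n - 28. Minimality allows a proper minor on w >= 9 vertices at most 5w - 15 edges, so
  removing one vertex must cost at least 6 edges. A contraction costs one edge plus one per
  triangle, a deletion costs the degree; hence the 5 triangles and the degree 6. If both sides of a
  separation of order s with middle S have at least 9 vertices, adding the two bounds gives e(S) +
  16 <= 5s, so s >= 4. Sides with 7 or 8 vertices escape this, because K7 and K8 have more than 5w -
  15 edges; most case distinctions come from these two sizes. Degree 6 stands apart because the
  neighbourhood is already complete: the condition on \<open>C\<close> is then vacuous, and one K7
  with one contracted component stays far below 30 edges. Two copies of K7 are needed. Sharing four
  vertices and keeping 7 and 6 vertices, they give 21 + 15 - 6 = 30 edges on 9 vertices.\<close>

definition sgraph :: "'a set \<Rightarrow> 'a rel \<Rightarrow> bool" where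
  "sgraph V E \<longleftrightarrow> finite V \<and> E \<subseteq> V \<times> V \<and> sym E \<and> irrefl E"

text \<open>The cut form of connectedness avoids induction along paths: unions, contractions and
  components only have to exhibit one arc leaving a given part.\<close>

definition conn :: "'a rel \<Rightarrow> 'a set \<Rightarrow> bool" where
  "conn E X \<longleftrightarrow> X \<noteq> {} \<and> (\<forall>Y. Y \<subseteq> X \<longrightarrow> Y \<noteq> {} \<longrightarrow> Y \<noteq> X \<longrightarrow> (\<exists>a\<in>Y. \<exists>b\<in>X - Y. (a, b) \<in> E))"

text \<open>The sets \<open>B w\<close> are the branch sets. Adjacencies between bags may be missing
  from \<open>F\<close>, so the deletion of edges is built in.\<close>

definition minor :: "'a set \<Rightarrow> 'a rel \<Rightarrow> 'a set \<Rightarrow> 'a rel \<Rightarrow> bool" where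
  "minor V E W F \<longleftrightarrow> (\<exists>B. (\<forall>w\<in>W. B w \<subseteq> V \<and> conn E (B w)) \<and>
     (\<forall>w\<in>W. \<forall>w'\<in>W. w \<noteq> w' \<longrightarrow> B w \<inter> B w' = {}) \<and>
     (\<forall>(w, w')\<in>F. \<exists>a\<in>B w. \<exists>b\<in>B w'. (a, b) \<in> E))"

lemma conn_nonempty: "conn E X \<Longrightarrow> X \<noteq> {}"
  by (simp add: conn_def)

lemma conn_cut: "conn E X \<Longrightarrow> Y \<subseteq> X \<Longrightarrow> Y \<noteq> {} \<Longrightarrow> Y \<noteq> X \<Longrightarrow> \<exists>a\<in>Y. \<exists>b\<in>X - Y. (a, b) \<in> E"
  by (simp add: conn_def)

lemma connI:
  "X \<noteq> {} \<Longrightarrow> (\<And>Y. Y \<subseteq> X \<Longrightarrow> Y \<noteq> {} \<Longrightarrow> Y \<noteq> X \<Longrightarrow> \<exists>a\<in>Y. \<exists>b\<in>X - Y. (a, b) \<in> E) \<Longrightarrow> conn E X"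
  by (simp add: conn_def)

lemma conn_singleton [simp]: "conn E {x}"
  by (auto simp: conn_def)

lemma conn_clique:
  assumes "X \<noteq> {}" "\<And>a b. a \<in> X \<Longrightarrow> b \<in> X \<Longrightarrow> a \<noteq> b \<Longrightarrow> (a, b) \<in> E"
  shows "conn E X"
proof (rule connI)
  fix Y assume "Y \<subseteq> X" "Y \<noteq> {}" "Y \<noteq> X"
  then obtain a b where "a \<in> Y" "b \<in> X" "b \<notin> Y" by blast
  with assms(2) \<open>Y \<subseteq> X\<close> show "\<exists>a\<in>Y. \<exists>b\<in>X - Y. (a, b) \<in> E" by blast
qed fact

lemma conn_mono: "conn E X \<Longrightarrow> E \<inter> X \<times> X \<subseteq> F \<Longrightarrow> conn F X"
  unfolding conn_def by blast

text \<open>A cut either splits some \<open>B i\<close>, whose own connectedness gives the arc, or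
  is a union of whole sets \<open>B i\<close>, and then it is a cut of \<open>I\<close> along
  \<open>F\<close>.\<close>

lemma conn_UN:
  assumes "conn F I" and B: "\<And>i. i \<in> I \<Longrightarrow> conn E (B i)"
    and F: "\<And>i j. (i, j) \<in> F \<Longrightarrow> i \<in> I \<Longrightarrow> j \<in> I \<Longrightarrow> \<exists>a\<in>B i. \<exists>b\<in>B j. (a, b) \<in> E"
  shows "conn E (\<Union>i\<in>I. B i)"
proof (rule connI)
  obtain i where "i \<in> I" using conn_nonempty[OF assms(1)] by blast
  with conn_nonempty[OF B] show "(\<Union>i\<in>I. B i) \<noteq> {}" by blast
next
  fix Y assume Y: "Y \<subseteq> (\<Union>i\<in>I. B i)" "Y \<noteq> {}" "Y \<noteq> (\<Union>i\<in>I. B i)"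
  show "\<exists>a\<in>Y. \<exists>b\<in>(\<Union>i\<in>I. B i) - Y. (a, b) \<in> E"
  proof (cases "\<exists>i\<in>I. B i \<inter> Y \<noteq> {} \<and> \<not> B i \<subseteq> Y")
    case True
    then obtain i where i: "i \<in> I" "B i \<inter> Y \<noteq> {}" "\<not> B i \<subseteq> Y" by blast
    obtain a b where "a \<in> B i \<inter> Y" "b \<in> B i - B i \<inter> Y" "(a, b) \<in> E"
      using conn_cut[OF B[OF i(1)], of "B i \<inter> Y"] i by blast
    with i(1) show ?thesis by blast
  next
    case False
    define J where "J = {i \<in> I. B i \<subseteq> Y}"
    have "J \<noteq> {}" "J \<noteq> I"
      using Y False unfolding J_def by blast+
    then obtain i j where ij: "i \<in> J" "j \<in> I - J" "(i, j) \<in> F"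
      using conn_cut[OF assms(1), of J] J_def by blast
    then obtain a b where "a \<in> B i" "b \<in> B j" "(a, b) \<in> E"
      using F J_def by blast
    with ij False show ?thesis unfolding J_def by blast
  qed
qed

lemma conn_Un:
  assumes "conn E X" "conn E Y" "sym E" "X \<inter> Y \<noteq> {} \<or> (\<exists>a\<in>X. \<exists>b\<in>Y. (a, b) \<in> E)"
  shows "conn E (X \<union> Y)"
proof (rule connI)
  show "X \<union> Y \<noteq> {}" using conn_nonempty[OF assms(1)] by simp
next
  fix Z assume Z: "Z \<subseteq> X \<union> Y" "Z \<noteq> {}" "Z \<noteq> X \<union> Y"
  consider "X \<inter> Z \<noteq> {}" "\<not> X \<subseteq> Z" | "Y \<inter> Z \<noteq> {}" "\<not> Y \<subseteq> Z"
    | "X \<subseteq> Z" "Y \<inter> Z = {}" | "Y \<subseteq> Z" "X \<inter> Z = {}"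
    using Z by blast
  then show "\<exists>a\<in>Z. \<exists>b\<in>X \<union> Y - Z. (a, b) \<in> E"
  proof cases
    case 1
    then show ?thesis using conn_cut[OF assms(1), of "X \<inter> Z"] by blast
  next
    case 2
    then show ?thesis using conn_cut[OF assms(2), of "Y \<inter> Z"] by blast
  next
    case 3
    with assms(4) show ?thesis by blast
  next
    case 4
    with assms(4) symD[OF assms(3)] show ?thesis by blast
  qed
qed

lemma minorI:
  assumes "\<And>w. w \<in> W \<Longrightarrow> B w \<subseteq> V" "\<And>w. w \<in> W \<Longrightarrow> conn E (B w)"
    "\<And>w w'. w \<in> W \<Longrightarrow> w' \<in> W \<Longrightarrow> w \<noteq> w' \<Longrightarrow> B w \<inter> B w' = {}"
    "\<And>w w'. (w, w') \<in> F \<Longrightarrow> \<exists>a\<in>B w. \<exists>b\<in>B w'. (a, b) \<in> E"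
  shows "minor V E W F"
  unfolding minor_def using assms by (intro exI[of _ B]) auto

lemma minorE:
  assumes "minor V E W F"
  obtains B where "\<And>w. w \<in> W \<Longrightarrow> B w \<subseteq> V" "\<And>w. w \<in> W \<Longrightarrow> conn E (B w)"
    "\<And>w w'. w \<in> W \<Longrightarrow> w' \<in> W \<Longrightarrow> w \<noteq> w' \<Longrightarrow> B w \<inter> B w' = {}"
    "\<And>w w'. (w, w') \<in> F \<Longrightarrow> \<exists>a\<in>B w. \<exists>b\<in>B w'. (a, b) \<in> E"
proof -
  obtain B where B: "\<forall>w\<in>W. B w \<subseteq> V \<and> conn E (B w)"
     "\<forall>w\<in>W. \<forall>w'\<in>W. w \<noteq> w' \<longrightarrow> B w \<inter> B w' = {}"
     "\<forall>(w, w')\<in>F. \<exists>a\<in>B w. \<exists>b\<in>B w'. (a, b) \<in> E"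
    using assms unfolding minor_def by (elim exE conjE)
  show ?thesis by (rule that[of B]) (use B in auto)
qed

lemma minor_mono:
  assumes "minor V E W F" "F' \<subseteq> F"
  shows "minor V E W F'"
  using assms(1)
proof (rule minorE)
  fix B assume B: "\<And>w. w \<in> W \<Longrightarrow> B w \<subseteq> V" "\<And>w. w \<in> W \<Longrightarrow> conn E (B w)"
    "\<And>w w'. w \<in> W \<Longrightarrow> w' \<in> W \<Longrightarrow> w \<noteq> w' \<Longrightarrow> B w \<inter> B w' = {}"
    "\<And>w w'. (w, w') \<in> F \<Longrightarrow> \<exists>a\<in>B w. \<exists>b\<in>B w'. (a, b) \<in> E"
  show ?thesis by (rule minorI[of W B, OF B(1-3) B(4)[OF subsetD[OF assms(2)]]])
qed

text \<open>A composite bag is the union of the \<open>B\<close>-bags over one \<open>C\<close>-bag;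
  \<open>conn_UN\<close> makes it connected.\<close>

lemma minor_trans:
  assumes "minor V E W F" "minor W F X H" "H \<subseteq> X \<times> X"
  shows "minor V E X H"
proof -
  obtain B where B: "\<And>w. w \<in> W \<Longrightarrow> B w \<subseteq> V" "\<And>w. w \<in> W \<Longrightarrow> conn E (B w)"
    "\<And>w w'. w \<in> W \<Longrightarrow> w' \<in> W \<Longrightarrow> w \<noteq> w' \<Longrightarrow> B w \<inter> B w' = {}"
    "\<And>w w'. (w, w') \<in> F \<Longrightarrow> \<exists>a\<in>B w. \<exists>b\<in>B w'. (a, b) \<in> E"
    by (rule minorE[OF assms(1)]) blast
  obtain C where C: "\<And>w. w \<in> X \<Longrightarrow> C w \<subseteq> W" "\<And>w. w \<in> X \<Longrightarrow> conn F (C w)"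
    "\<And>w w'. w \<in> X \<Longrightarrow> w' \<in> X \<Longrightarrow> w \<noteq> w' \<Longrightarrow> C w \<inter> C w' = {}"
    "\<And>w w'. (w, w') \<in> H \<Longrightarrow> \<exists>a\<in>C w. \<exists>b\<in>C w'. (a, b) \<in> F"
    by (rule minorE[OF assms(2)]) blast
  show ?thesis
  proof (rule minorI[of X "\<lambda>x. \<Union>w\<in>C x. B w"])
    show "(\<Union>w\<in>C x. B w) \<subseteq> V" if "x \<in> X" for x using B(1) C(1) that by blast
    show "conn E (\<Union>w\<in>C x. B w)" if "x \<in> X" for x
      using C(1,2)[OF that] B(2,4) by (intro conn_UN[of F]) auto
    show "(\<Union>w\<in>C x. B w) \<inter> (\<Union>w\<in>C x'. B w) = {}" if "x \<in> X" "x' \<in> X" "x \<noteq> x'" for x x'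
    proof -
      have "B w \<inter> B w' = {}" if "w \<in> C x" "w' \<in> C x'" for w w'
      proof -
        have "w \<noteq> w'" using C(3)[OF \<open>x \<in> X\<close> \<open>x' \<in> X\<close> \<open>x \<noteq> x'\<close>] that by blast
        moreover have "w \<in> W" "w' \<in> W" using C(1) \<open>x \<in> X\<close> \<open>x' \<in> X\<close> that by blast+
        ultimately show ?thesis by (rule B(3)[rotated 2])
      qed
      then show ?thesis by blast
    qed
    show "\<exists>a\<in>(\<Union>w\<in>C x. B w). \<exists>b\<in>(\<Union>w\<in>C x'. B w). (a, b) \<in> E" if "(x, x') \<in> H" for x x'
      using C(4)[OF that] B(4) by blast
  qed
qed

lemma minor_sub:
  assumes "A \<subseteq> V" "F \<subseteq> E"
  shows "minor V E A F"
  by (rule minorI[of _ "\<lambda>w. {w}"]) (use assms in auto)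

section \<open>Contracting a set to one vertex, contracting an edge, and the arc counts\<close>

definition attach :: "'a rel \<Rightarrow> 'a set \<Rightarrow> 'a \<Rightarrow> 'a set \<Rightarrow> 'a rel" where
  "attach E A c N = E \<inter> A \<times> A \<union> {c} \<times> (N \<inter> A) \<union> (N \<inter> A) \<times> {c}"

lemma sgraph_Int: "sgraph V E \<Longrightarrow> A \<subseteq> V \<Longrightarrow> sgraph A (E \<inter> A \<times> A)"
  unfolding sgraph_def sym_def irrefl_def by (auto dest: finite_subset)

lemma sgraph_attach:
  assumes "sgraph V E" "A \<subseteq> V" "c \<notin> A"
  shows "sgraph (insert c A) (attach E A c N)"
  using assms unfolding sgraph_def attach_def sym_def irrefl_def
  by (auto dest: finite_subset)

lemma card_attach:
  assumes "finite A" "c \<notin> A"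
  shows "card (attach E A c N) = card (E \<inter> A \<times> A) + 2 * card (N \<inter> A)"
proof -
  have fin: "finite (E \<inter> A \<times> A)" "finite (N \<inter> A)" using assms(1) by auto
  have "card (attach E A c N) = card (E \<inter> A \<times> A \<union> {c} \<times> (N \<inter> A)) + card ((N \<inter> A) \<times> {c})"
    unfolding attach_def using fin assms(2) by (subst card_Un_disjoint) auto
  also have "card (E \<inter> A \<times> A \<union> {c} \<times> (N \<inter> A)) = card (E \<inter> A \<times> A) + card ({c} \<times> (N \<inter> A))"
    using fin assms(2) by (subst card_Un_disjoint) auto
  finally show ?thesis by (simp add: card_cartesian_product)
qed

text \<open>All of \<open>C\<close> is the bag of \<open>c\<close>, every other bag is a singleton.
  Naming the contracted vertex after a member of \<open>C\<close> keeps the vertex type.\<close>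

lemma minor_attach:
  assumes "sgraph V E" "A \<subseteq> V" "C \<subseteq> V" "conn E C" "A \<inter> C = {}" "c \<in> C"
  shows "minor V E (insert c A) (attach E A c (E `` C))"
proof (rule minorI[of _ "\<lambda>w. if w = c then C else {w}"])
  have s: "sym E" using assms(1) by (simp add: sgraph_def)
  show "\<exists>a\<in>if w = c then C else {w}. \<exists>b\<in>if w' = c then C else {w'}. (a, b) \<in> E"
    if "(w, w') \<in> attach E A c (E `` C)" for w w'
    using that assms(5,6) unfolding attach_def by (auto dest: symD[OF s])
qed (use assms in \<open>auto split: if_splits\<close>)

definition contr :: "'a rel \<Rightarrow> 'a \<Rightarrow> 'a \<Rightarrow> 'a rel" where
  "contr F u v = {(a, b). a \<noteq> b \<and> a \<noteq> v \<and> b \<noteq> v \<and>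
     ((a, b) \<in> F \<or> a = u \<and> (v, b) \<in> F \<or> b = u \<and> (a, v) \<in> F)}"

lemma sgraph_contr:
  assumes "sgraph V F" "(u, v) \<in> F"
  shows "sgraph (V - {v}) (contr F u v)"
  using assms unfolding sgraph_def contr_def sym_def irrefl_def by auto

lemma minor_contr:
  assumes "sgraph V F" "(u, v) \<in> F"
  shows "minor V F (V - {v}) (contr F u v)"
proof (rule minorI[of _ "\<lambda>w. if w = u then {u, v} else {w}"])
  have *: "sym F" "u \<noteq> v" "u \<in> V" "v \<in> V" using assms by (auto simp: sgraph_def irrefl_def)
  have "conn F ({u} \<union> {v})" by (rule conn_Un) (use assms(2) * in auto)
  then have "conn F {u, v}" by (simp add: insert_commute)
  then show "conn F (if w = u then {u, v} else {w})" for w by simp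
  show "(if w = u then {u, v} else {w}) \<subseteq> V" if "w \<in> V - {v}" for w using that * by auto
  show "\<exists>a\<in>if w = u then {u, v} else {w}. \<exists>b\<in>if w' = u then {u, v} else {w'}. (a, b) \<in> F"
    if "(w, w') \<in> contr F u v" for w w'
    using that unfolding contr_def by auto
qed auto

text \<open>The lost edges are \<open>uv\<close> itself and, for each common neighbour, one of two
  edges that become parallel.\<close>

lemma card_contr:
  assumes "sgraph V F" "(u, v) \<in> F"
  shows "card (contr F u v) + 2 + 2 * card (F `` {u} \<inter> F `` {v}) = card F"
proof -
  have F: "finite V" "F \<subseteq> V \<times> V" "\<And>a b. (a, b) \<in> F \<Longrightarrow> (b, a) \<in> F" "\<And>a. (a, a) \<notin> F"
    using assms by (auto simp: sgraph_def sym_def irrefl_def)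
  have fin: "finite F" "\<And>x. finite (F `` {x})"
    using F(1,2) by (auto intro: finite_subset[of _ "V \<times> V"] finite_subset[of _ V])
  define N where "N = F `` {v} - {u}"
  define M where "M = F `` {u} - {v}"
  define R where "R = {(a, b) \<in> F. a \<noteq> v \<and> b \<noteq> v}"
  have finN: "finite N" "finite M" "finite R" using fin by (auto simp: N_def M_def R_def intro: finite_subset[of _ F])
  have 1: "F = R \<union> ({v} \<times> F `` {v} \<union> F `` {v} \<times> {v})"
    using F(3) by (auto simp: R_def)
  have c1: "card F = card R + 2 * card (F `` {v})"
  proof -
    have "card F = card R + card ({v} \<times> F `` {v} \<union> F `` {v} \<times> {v})"
      by (subst (1) 1, subst card_Un_disjoint) (use fin finN F in \<open>auto simp: R_def\<close>)
    also have "card ({v} \<times> F `` {v} \<union> F `` {v} \<times> {v}) = 2 * card (F `` {v})"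
      by (subst card_Un_disjoint) (use fin F(4) in \<open>auto simp: card_cartesian_product\<close>)
    finally show ?thesis .
  qed
  \<comment> \<open>\<open>N - M\<close> consists of the neighbours that \<open>v\<close> hands over
    to \<open>u\<close> and that \<open>u\<close> did not have before.\<close>
  have 2: "contr F u v = R \<union> ({u} \<times> (N - M) \<union> (N - M) \<times> {u})"
    using F(3,4) by (auto simp: R_def contr_def N_def M_def)
  have c2: "card (contr F u v) = card R + 2 * card (N - M)"
  proof -
    have "card (contr F u v) = card R + card ({u} \<times> (N - M) \<union> (N - M) \<times> {u})"
      by (subst 2, subst card_Un_disjoint) (use fin finN F(3,4) in \<open>auto simp: R_def N_def M_def\<close>)
    also have "card ({u} \<times> (N - M) \<union> (N - M) \<times> {u}) = 2 * card (N - M)"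
      by (subst card_Un_disjoint) (use finN in \<open>auto simp: card_cartesian_product N_def\<close>)
    finally show ?thesis .
  qed
  have 3: "F `` {v} = insert u ((N - M) \<union> (F `` {u} \<inter> F `` {v}))"
    using assms(2) F(3,4) by (auto simp: N_def M_def)
  have "card (F `` {v}) = 1 + card (N - M) + card (F `` {u} \<inter> F `` {v})"
    by (subst 3, subst card_insert_disjoint, use fin finN F in \<open>auto simp: N_def M_def\<close>)
       (subst card_Un_disjoint, use fin in auto)
  then show ?thesis using c1 c2 by simp
qed

section \<open>Components and Menger's theorem\<close>

definition component :: "'a rel \<Rightarrow> 'a set \<Rightarrow> 'a set \<Rightarrow> bool" where
  "component E Z C \<longleftrightarrow> C \<subseteq> Z \<and> conn E C \<and> E `` C \<inter> Z \<subseteq> C"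

lemma component_exists:
  assumes "sym E" "x \<in> Z"
  obtains C where "component E Z C" "x \<in> C"
proof -
  define R where "R = E \<inter> Z \<times> Z"
  define C where "C = R\<^sup>* `` {x}"
  have x: "x \<in> C" by (simp add: C_def)
  have CZ: "C \<subseteq> Z"
  proof
    fix y assume "y \<in> C"
    then have "(x, y) \<in> R\<^sup>*" by (simp add: C_def)
    then show "y \<in> Z" by (induction) (use assms(2) in \<open>auto simp: R_def\<close>)
  qed
  have closed: "z \<in> C" if "y \<in> C" "(y, z) \<in> E" "z \<in> Z" for y z
  proof -
    have "(y, z) \<in> R" using that CZ by (auto simp: R_def)
    with \<open>y \<in> C\<close> show ?thesis by (auto simp: C_def intro: rtrancl_into_rtrancl)
  qed
  have cut: "\<exists>a\<in>Y. \<exists>b\<in>C - Y. (a, b) \<in> E" if "Y \<subseteq> C" "x \<in> Y" "Y \<noteq> C" for Y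
  proof (rule ccontr)
    assume neg: "\<not> ?thesis"
    have "y \<in> Y" if "(x, y) \<in> R\<^sup>*" for y
      using that
    proof induction
      case base
      then show ?case by fact
    next
      case (step y z)
      then have "(y, z) \<in> E" "z \<in> Z" by (auto simp: R_def)
      then have "z \<in> C" using closed step.IH \<open>Y \<subseteq> C\<close> by blast
      with neg step.IH \<open>(y, z) \<in> E\<close> show ?case by blast
    qed
    then have "C \<subseteq> Y" by (auto simp: C_def)
    with that show False by blast
  qed
  have "conn E C"
  proof (rule connI)
    show "C \<noteq> {}" using x by blast
    fix Y assume Y: "Y \<subseteq> C" "Y \<noteq> {}" "Y \<noteq> C"
    show "\<exists>a\<in>Y. \<exists>b\<in>C - Y. (a, b) \<in> E"
    proof (cases "x \<in> Y")
      case True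
      with cut Y show ?thesis by blast
    next
      case False
      \<comment> \<open>\<open>cut\<close> covers the parts containing \<open>x\<close>. Here the
        complement contains \<open>x\<close>, and symmetry reverses the arc found.\<close>
      have "\<exists>a\<in>C - Y. \<exists>b\<in>C - (C - Y). (a, b) \<in> E"
        by (rule cut) (use False x Y in blast)+
      with assms(1) Y show ?thesis by (auto dest: symD)
    qed
  qed
  with CZ closed have "component E Z C" unfolding component_def by blast
  with x show ?thesis by (rule that[rotated])
qed

text \<open>If \<open>D\<close> left \<open>C\<close>, connectedness of \<open>D\<close> would give
  an arc from \<open>C\<close> to a vertex of \<open>Z\<close> outside \<open>C\<close>.\<close>

lemma component_absorbs:
  assumes "component E Z C" "conn E D" "D \<subseteq> Z" "D \<inter> C \<noteq> {}"
  shows "D \<subseteq> C"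
proof (rule ccontr)
  assume "\<not> D \<subseteq> C"
  then obtain a b where "a \<in> D \<inter> C" "b \<in> D - D \<inter> C" "(a, b) \<in> E"
    using conn_cut[OF assms(2), of "D \<inter> C"] assms(4) by blast
  with assms(1,3) show False by (auto simp: component_def)
qed

section \<open>Separations, linkages and Menger's theorem\<close>

definition separation :: "'a set \<Rightarrow> 'a rel \<Rightarrow> 'a set \<Rightarrow> 'a set \<Rightarrow> 'a set \<Rightarrow> 'a set \<Rightarrow> bool" where
  "separation V E A B X Y \<longleftrightarrow> X \<union> Y = V \<and> A \<subseteq> X \<and> B \<subseteq> Y \<and> E \<inter> (X - Y) \<times> (Y - X) = {}"

text \<open>Disjoint \<open>A\<close>-\<open>B\<close> paths, recorded only as connected vertex sets with one vertex in \<open>A\<close> and one in \<open>B\<close>.\<close>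

definition linkage :: "'a set \<Rightarrow> 'a rel \<Rightarrow> 'a set \<Rightarrow> 'a set \<Rightarrow> 'a set set \<Rightarrow> bool" where
  "linkage V E A B \<P> \<longleftrightarrow>
     (\<forall>P\<in>\<P>. P \<subseteq> V \<and> conn E P \<and> (\<exists>a. P \<inter> A = {a}) \<and> (\<exists>b. P \<inter> B = {b})) \<and>
     (\<forall>P\<in>\<P>. \<forall>Q\<in>\<P>. P \<noteq> Q \<longrightarrow> P \<inter> Q = {})"

lemma linkageD:
  assumes "linkage V E A B \<P>" "P \<in> \<P>"
  shows "P \<subseteq> V" "conn E P" "\<exists>a. P \<inter> A = {a}" "\<exists>b. P \<inter> B = {b}"
    "\<And>Q. Q \<in> \<P> \<Longrightarrow> P \<noteq> Q \<Longrightarrow> P \<inter> Q = {}"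
  using assms unfolding linkage_def by blast+

lemma linkage_swap: "linkage V E A B \<P> \<Longrightarrow> linkage V E B A \<P>"
  unfolding linkage_def by blast

text \<open>Sending a path to its end in \<open>A\<close> is injective because the paths are
  disjoint.\<close>

lemma linkage_card_ends:
  assumes "linkage V E A B \<P>"
  shows "card (A \<inter> \<Union>\<P>) = card \<P>"
proof -
  have "\<exists>h. \<forall>P\<in>\<P>. P \<inter> A = {h P}"
    using linkageD(3)[OF assms] by (intro bchoice) auto
  then obtain h where h: "\<And>P. P \<in> \<P> \<Longrightarrow> P \<inter> A = {h P}" by blast
  have "inj_on h \<P>"
  proof (rule inj_onI, rule ccontr)
    fix P Q assume *: "P \<in> \<P>" "Q \<in> \<P>" "h P = h Q" "P \<noteq> Q"
    then have "h P \<in> P \<inter> Q" using h[of P] h[of Q] by blast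
    with linkageD(5)[OF assms] * show False by blast
  qed
  moreover have "A \<inter> \<Union>\<P> = h ` \<P>" using h by blast
  ultimately show ?thesis by (simp add: card_image)
qed

text \<open>When there are as many paths as vertices of \<open>B\<close>, the ends exhaust
  \<open>B\<close>. This lets paths be indexed by their ends when two linkages are glued.\<close>

lemma linkage_end:
  assumes "linkage V E A B \<P>" "finite B" "card \<P> = card B" "w \<in> B"
  shows "\<exists>P\<in>\<P>. P \<inter> B = {w}"
proof -
  have "card (B \<inter> \<Union>\<P>) = card B"
    using linkage_card_ends[OF linkage_swap[OF assms(1)]] assms(3) by simp
  then have "B \<inter> \<Union>\<P> = B" using assms(2) by (intro card_subset_eq) auto
  then obtain P where P: "P \<in> \<P>" "w \<in> P" using assms(4) by blast
  then obtain b where "P \<inter> B = {b}" using linkageD(4)[OF assms(1)] by blast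
  moreover from this have "w = b" using P(2) assms(4) by auto
  ultimately show ?thesis using P(1) by blast
qed

text \<open>Goering's argument: delete an edge, and if that creates a smaller separation \<open>(X, Y)\<close>, link through
  the two sides.\<close>

theorem menger:
  assumes "sgraph V E" "A \<subseteq> V" "B \<subseteq> V"
    and "\<And>X Y. separation V E A B X Y \<Longrightarrow> k \<le> card (X \<inter> Y)"
  shows "\<exists>\<P>. card \<P> = k \<and> linkage V E A B \<P>"
  using assms
proof (induction "card E" arbitrary: V E A B rule: less_induct)
  case less
  have finV: "finite V" and EV: "E \<subseteq> V \<times> V" and sE: "sym E" and iE: "irrefl E"
    using less.prems(1) by (auto simp: sgraph_def)
  have finE: "finite E" using finV EV by (meson finite_SigmaI finite_subset)
  show ?case
  proof (cases "E = {}")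
    case True
    \<comment> \<open>Without edges the only paths are single vertices of
      \<open>A \<inter> B\<close>, and this separation has exactly that set as its middle.\<close>
    have "separation V E A B A ((V - A) \<union> (A \<inter> B))"
      using less.prems(2,3) True by (auto simp: separation_def)
    then have "k \<le> card (A \<inter> ((V - A) \<union> (A \<inter> B)))" by (rule less.prems(4))
    also have "A \<inter> ((V - A) \<union> (A \<inter> B)) = A \<inter> B" by blast
    finally obtain T where T: "T \<subseteq> A \<inter> B" "card T = k" by (meson obtain_subset_with_card_n)
    have "card ((\<lambda>x. {x}) ` T) = k" using T(2) by (simp add: card_image)
    moreover have "linkage V E A B ((\<lambda>x. {x}) ` T)"
      using T(1) less.prems(2) unfolding linkage_def by auto
    ultimately show ?thesis by blast
  next
    case False
    then obtain u v where uv: "(u, v) \<in> E" by auto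
    show ?thesis
    proof (cases "\<forall>X Y. separation V (E - {(u, v), (v, u)}) A B X Y \<longrightarrow> k \<le> card (X \<inter> Y)")
      case True
      have sg: "sgraph V (E - {(u, v), (v, u)})"
        using less.prems(1) by (auto simp: sgraph_def sym_def irrefl_def)
      have "card (E - {(u, v), (v, u)}) < card E"
        using uv finE by (intro psubset_card_mono) auto
      then obtain \<P> where \<P>: "card \<P> = k" "linkage V (E - {(u, v), (v, u)}) A B \<P>"
        using less.hyps[OF _ sg less.prems(2,3)] True by blast
      have "linkage V E A B \<P>"
        using \<P>(2) unfolding linkage_def by (meson Diff_subset conn_mono inf.coboundedI1)
      with \<P>(1) show ?thesis by blast
    next
      case no: False
      then obtain X Y where XY: "separation V (E - {(u, v), (v, u)}) A B X Y" "card (X \<inter> Y) < k"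
        by (auto simp: not_le)
      have "\<not> separation V E A B X Y" using less.prems(4) XY(2) by fastforce
      \<comment> \<open>Only the deleted edge can cross \<open>(X, Y)\<close>; \<open>a\<close> and
        \<open>b\<close> are its ends, named so that it runs from the \<open>X\<close> side to the
        \<open>Y\<close> side.\<close>
      then obtain a b where ab: "(a, b) \<in> E" "a \<in> X - Y" "b \<in> Y - X"
        using XY(1) unfolding separation_def by blast
      define E' where "E' = E - {(a, b), (b, a)}"
      have "(a, b) = (u, v) \<or> (a, b) = (v, u)" using XY(1) ab unfolding separation_def by blast
      then have "E' = E - {(u, v), (v, u)}" by (auto simp: E'_def)
      with XY(1) have sep: "X \<union> Y = V" "A \<subseteq> X" "B \<subseteq> Y" "E' \<inter> (X - Y) \<times> (Y - X) = {}"
        by (auto simp: separation_def)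
      define S where "S = X \<inter> Y"
      have finS: "finite S" using finV sep(1) by (auto simp: S_def)
      have aS: "a \<notin> S" "b \<notin> S" using ab by (auto simp: S_def)
      \<comment> \<open>Moving \<open>b\<close> into the first part makes the edge \<open>ab\<close>
        harmless at the cost of one vertex, so \<open>card S\<close> is exactly \<open>k - 1\<close>
        and both glued linkages have exactly as many paths as \<open>insert a S\<close> and
        \<open>insert b S\<close> have vertices.\<close>
      have "separation V E A B (insert b X) Y"
        using sep ab(3) unfolding separation_def E'_def by blast
      then have "k \<le> card (insert b X \<inter> Y)" by (rule less.prems(4))
      also have "insert b X \<inter> Y = insert b S" using ab(3) by (auto simp: S_def)
      finally have kS: "k = Suc (card S)" using XY(2) aS finS by (simp add: S_def)
      have sE': "sym E'" using sE by (auto simp: E'_def sym_def)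
      have E'E: "E' \<subset> E" using ab(1) by (auto simp: E'_def)
      have sg: "sgraph Z (E' \<inter> Z \<times> Z)" if "Z \<subseteq> V" for Z
        using that finV sE' iE E'E by (auto simp: sgraph_def sym_def irrefl_def dest: finite_subset)
      have lt: "card (E' \<inter> Z \<times> Z) < card E" for Z
        using E'E finE by (intro psubset_card_mono) auto
      have "\<exists>\<P>. card \<P> = k \<and> linkage X (E' \<inter> X \<times> X) A (insert a S) \<P>"
      proof (rule less.hyps[OF lt sg])
        show "X \<subseteq> V" "A \<subseteq> X" "insert a S \<subseteq> X" using sep ab by (auto simp: S_def)
        fix X1 Y1 assume s1: "separation X (E' \<inter> X \<times> X) A (insert a S) X1 Y1"
        \<comment> \<open>A separation of the \<open>X\<close> side extends to the whole graph by
          adding \<open>Y\<close> to its second part: \<open>a\<close> and \<open>S\<close> lie in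
          \<open>Y1\<close>, so the edge \<open>ab\<close> does not cross.\<close>
        have "separation V E A B X1 (Y1 \<union> Y)"
          unfolding separation_def
        proof (intro conjI)
          show "X1 \<union> (Y1 \<union> Y) = V" "A \<subseteq> X1" "B \<subseteq> Y1 \<union> Y"
            using s1 sep by (auto simp: separation_def)
          have "False" if "(p, q) \<in> E" "p \<in> X1" "p \<notin> Y1" "p \<notin> Y" "q \<in> Y1 \<union> Y" "q \<notin> X1" for p q
          proof -
            have "p \<noteq> a" "p \<in> X" using s1 that unfolding separation_def by blast+
            moreover have "p \<noteq> b" using that ab(3) by blast
            ultimately have pq: "(p, q) \<in> E'" using that(1) by (auto simp: E'_def)
            show False
            proof (cases "q \<in> X")
              case True
              then have "q \<in> Y1" using s1 that unfolding separation_def by blast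
              then show False using s1 that pq True \<open>p \<in> X\<close> unfolding separation_def by blast
            next
              case False
              then have "q \<in> Y" using s1 that unfolding separation_def by blast
              then show False using sep(4) pq False \<open>p \<in> X\<close> that by blast
            qed
          qed
          then show "E \<inter> (X1 - (Y1 \<union> Y)) \<times> (Y1 \<union> Y - X1) = {}" by blast
        qed
        then have "k \<le> card (X1 \<inter> (Y1 \<union> Y))" by (rule less.prems(4))
        also have "X1 \<inter> (Y1 \<union> Y) = X1 \<inter> Y1"
          using s1 unfolding separation_def S_def by blast
        finally show "k \<le> card (X1 \<inter> Y1)" .
      qed
      then obtain \<P> where \<P>: "card \<P> = k" "linkage X (E' \<inter> X \<times> X) A (insert a S) \<P>" by blast
      have "\<exists>\<Q>. card \<Q> = k \<and> linkage Y (E' \<inter> Y \<times> Y) (insert b S) B \<Q>"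
      proof (rule less.hyps[OF lt sg])
        show "Y \<subseteq> V" "B \<subseteq> Y" "insert b S \<subseteq> Y" using sep ab by (auto simp: S_def)
        fix X2 Y2 assume s2: "separation Y (E' \<inter> Y \<times> Y) (insert b S) B X2 Y2"
        have "separation V E A B (X \<union> X2) Y2"
          unfolding separation_def
        proof (intro conjI)
          show "X \<union> X2 \<union> Y2 = V" "A \<subseteq> X \<union> X2" "B \<subseteq> Y2"
            using s2 sep by (auto simp: separation_def)
          have "False" if "(p, q) \<in> E" "p \<in> X \<union> X2" "p \<notin> Y2" "q \<in> Y2" "q \<notin> X" "q \<notin> X2" for p q
          proof -
            have "q \<noteq> b" "q \<in> Y" using s2 that unfolding separation_def by blast+
            moreover have "q \<noteq> a" using that ab(2) by blast
            ultimately have pq: "(p, q) \<in> E'" using that(1) by (auto simp: E'_def)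
            show False
            proof (cases "p \<in> Y")
              case True
              then have "p \<in> X2" using s2 that unfolding separation_def by blast
              then show False using s2 that pq True \<open>q \<in> Y\<close> unfolding separation_def by blast
            next
              case False
              then have "p \<in> X" using s2 that unfolding separation_def by blast
              then show False using sep(4) pq False \<open>q \<in> Y\<close> that by blast
            qed
          qed
          then show "E \<inter> (X \<union> X2 - Y2) \<times> (Y2 - (X \<union> X2)) = {}" by blast
        qed
        then have "k \<le> card ((X \<union> X2) \<inter> Y2)" by (rule less.prems(4))
        also have "(X \<union> X2) \<inter> Y2 = X2 \<inter> Y2"
          using s2 unfolding separation_def S_def by blast
        finally show "k \<le> card (X2 \<inter> Y2)" .
      qed
      then obtain \<Q> where \<Q>: "card \<Q> = k" "linkage Y (E' \<inter> Y \<times> Y) (insert b S) B \<Q>" by blast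
      have "\<exists>f. \<forall>w\<in>insert a S. f w \<in> \<P> \<and> f w \<inter> insert a S = {w}"
        by (intro bchoice ballI) (use linkage_end[OF \<P>(2)] \<P>(1) finS aS kS in auto)
      then obtain f where f: "\<And>w. w \<in> insert a S \<Longrightarrow> f w \<in> \<P>"
        "\<And>w. w \<in> insert a S \<Longrightarrow> f w \<inter> insert a S = {w}" by blast
      have "\<exists>g. \<forall>w\<in>insert b S. g w \<in> \<Q> \<and> g w \<inter> insert b S = {w}"
        by (intro bchoice ballI)
          (use linkage_end[OF linkage_swap[OF \<Q>(2)]] \<Q>(1) finS aS kS in auto)
      then obtain g where g: "\<And>w. w \<in> insert b S \<Longrightarrow> g w \<in> \<Q>"
        "\<And>w. w \<in> insert b S \<Longrightarrow> g w \<inter> insert b S = {w}" by blast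
      \<comment> \<open>The gluing rule: paths ending in the same vertex of \<open>S\<close> are
        joined there, and the path ending in \<open>a\<close> is joined to the one starting in
        \<open>b\<close> along the edge \<open>ab\<close>.\<close>
      define \<sigma> where "\<sigma> w = (if w = a then b else w)" for w
      have \<sigma>: "\<sigma> w \<in> insert b S" if "w \<in> insert a S" for w using that by (auto simp: \<sigma>_def)
      define R where "R w = f w \<union> g (\<sigma> w)" for w
      have fX: "f w \<subseteq> X" "conn E (f w)" "\<exists>c. f w \<inter> A = {c}" if "w \<in> insert a S" for w
        using linkageD[OF \<P>(2) f(1)[OF that]] E'E by (auto intro: conn_mono)
      have gY: "g w \<subseteq> Y" "conn E (g w)" "\<exists>c. g w \<inter> B = {c}" if "w \<in> insert b S" for w
        using linkageD[OF \<Q>(2) g(1)[OF that]] E'E by (auto intro: conn_mono)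
      have fd: "f w \<inter> f w' = {}" if "w \<in> insert a S" "w' \<in> insert a S" "w \<noteq> w'" for w w'
      proof -
        have "f w \<noteq> f w'" using f(2)[OF that(1)] f(2)[OF that(2)] that(3) by auto
        then show ?thesis using linkageD(5)[OF \<P>(2) f(1) f(1)] that by blast
      qed
      have gd: "g w \<inter> g w' = {}" if "w \<in> insert b S" "w' \<in> insert b S" "w \<noteq> w'" for w w'
      proof -
        have "g w \<noteq> g w'" using g(2)[OF that(1)] g(2)[OF that(2)] that(3) by auto
        then show ?thesis using linkageD(5)[OF \<Q>(2) g(1) g(1)] that by blast
      qed
      have fg: "x = w \<and> x = w'" if "w \<in> insert a S" "w' \<in> insert b S" "x \<in> f w" "x \<in> g w'" for w w' x
      proof -
        have "x \<in> S" using that fX(1) gY(1) unfolding S_def by blast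
        then show ?thesis using f(2)[OF that(1)] g(2)[OF that(2)] that by blast
      qed
      have fgS: "f w \<inter> Y \<subseteq> {w}" if "w \<in> insert a S" for w
        using f(2)[OF that] fX(1)[OF that] unfolding S_def by blast
      have gfS: "g w \<inter> X \<subseteq> {w}" if "w \<in> insert b S" for w
        using g(2)[OF that] gY(1)[OF that] unfolding S_def by blast
      have mem: "w \<in> f w" "\<sigma> w \<in> g (\<sigma> w)" if "w \<in> insert a S" for w
        using f(2)[OF that] g(2)[OF \<sigma>[OF that]] by blast+
      have Rd: "R w \<inter> R w' = {}" if "w \<in> insert a S" "w' \<in> insert a S" "w \<noteq> w'" for w w'
      proof -
        have ne: "\<sigma> w \<noteq> \<sigma> w'" using that aS by (auto simp: \<sigma>_def)
        have "w \<noteq> \<sigma> w'" "w' \<noteq> \<sigma> w" using that aS ab by (auto simp: \<sigma>_def)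
        then show ?thesis
          using fd[OF that] gd[OF \<sigma> \<sigma> ne, OF that(1,2)] fg[OF that(1) \<sigma>[OF that(2)]]
            fg[OF that(2) \<sigma>[OF that(1)]]
          unfolding R_def by blast
      qed
      have "card (R ` insert a S) = k"
      proof -
        have "inj_on R (insert a S)"
        proof (rule inj_onI, rule ccontr)
          fix w w' assume "w \<in> insert a S" "w' \<in> insert a S" "R w = R w'" "w \<noteq> w'"
          with Rd[of w w'] mem(1)[of w] show False by (auto simp: R_def)
        qed
        then show ?thesis using aS finS kS by (simp add: card_image)
      qed
      moreover have "linkage V E A B (R ` insert a S)"
        unfolding linkage_def
      proof (intro conjI ballI impI)
        fix P assume "P \<in> R ` insert a S"
        then obtain w where w: "w \<in> insert a S" "P = R w" by blast
        note w' = \<sigma>[OF w(1)]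
        show "P \<subseteq> V" using fX(1)[OF w(1)] gY(1)[OF w'] sep(1) w(2) by (auto simp: R_def)
        have "f w \<inter> g (\<sigma> w) \<noteq> {} \<or> (\<exists>p\<in>f w. \<exists>q\<in>g (\<sigma> w). (p, q) \<in> E)"
          using mem[OF w(1)] ab(1) by (cases "w = a") (auto simp: \<sigma>_def)
        then show "conn E P"
          unfolding w(2) R_def using fX(2)[OF w(1)] gY(2)[OF w'] sE by (intro conn_Un)
        \<comment> \<open>A path of the \<open>Y\<close> side meets \<open>X\<close> at most in its
          own end, so it contributes no second vertex of \<open>A\<close>.\<close>
        have "g (\<sigma> w) \<inter> A \<subseteq> f w"
        proof -
          have "g (\<sigma> w) \<inter> A \<subseteq> {\<sigma> w}" using gfS[OF w'] sep(2) by blast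
          moreover have "\<sigma> w \<notin> A" if "\<sigma> w \<noteq> w"
            using that ab(3) sep(2) by (auto simp: \<sigma>_def split: if_splits)
          ultimately show ?thesis using mem(1)[OF w(1)] by (cases "\<sigma> w = w") auto
        qed
        then have "P \<inter> A = f w \<inter> A" by (auto simp: w(2) R_def)
        then show "\<exists>a. P \<inter> A = {a}" using fX(3)[OF w(1)] by simp
        have "f w \<inter> B \<subseteq> g (\<sigma> w)"
        proof -
          have "f w \<inter> B \<subseteq> {w}" using fgS[OF w(1)] sep(3) by blast
          moreover have "w \<notin> B" if "\<sigma> w \<noteq> w"
            using that ab(2) sep(3) by (auto simp: \<sigma>_def split: if_splits)
          ultimately show ?thesis using mem(2)[OF w(1)] by (cases "\<sigma> w = w") auto
        qed
        then have "P \<inter> B = g (\<sigma> w) \<inter> B" by (auto simp: w(2) R_def)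
        then show "\<exists>b. P \<inter> B = {b}" using gY(3)[OF w'] by simp
      next
        fix P Q assume "P \<in> R ` insert a S" "Q \<in> R ` insert a S" "P \<noteq> Q"
        then show "P \<inter> Q = {}" using Rd by blast
      qed
      ultimately show ?thesis by blast
    qed
  qed
qed

section \<open>From bags to contractions\<close>

definition good :: "'a set \<Rightarrow> 'a rel \<Rightarrow> bool" where
  "good V E \<longleftrightarrow> (\<exists>W F. minor V E W F \<and> sgraph W F \<and> card W = 9 \<and> 60 \<le> card F)"

lemma contracts_to_trans: "contracts_to M N \<Longrightarrow> contracts_to G M \<Longrightarrow> contracts_to G N"
  by (induction rule: contracts_to.induct) (auto intro: contracts_to.step)

lemma pair_graph_sgraph: "pair_graph G \<longleftrightarrow> sgraph (pverts G) (parcs G)"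
  by (simp add: pair_graph_iff sgraph_def)

text \<open>\<open>\<rho>\<close> picks a representative in each connected class. Contracting one
  edge from a representative to another vertex of its class removes that vertex and leaves the
  quotient unchanged, so induction on the number of vertices applies with the same
  \<open>\<rho>\<close>.\<close>

lemma contracts_to_quotient:
  assumes "pair_graph S"
    and "\<And>x. x \<in> pverts S \<Longrightarrow> \<rho> x \<in> pverts S \<and> \<rho> (\<rho> x) = \<rho> x"
    and "\<And>x. x \<in> pverts S \<Longrightarrow> conn (parcs S) {y \<in> pverts S. \<rho> y = \<rho> x}"
  shows "contracts_to S \<lparr>pverts = \<rho> ` pverts S,
    parcs = {(\<rho> x, \<rho> y) | x y. (x, y) \<in> parcs S \<and> \<rho> x \<noteq> \<rho> y}\<rparr>" (is "contracts_to S (?Q S)")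
  using assms
proof (induction "card (pverts S)" arbitrary: S rule: less_induct)
  case less
  have S: "finite (pverts S)" "parcs S \<subseteq> pverts S \<times> pverts S" "irrefl (parcs S)" "sym (parcs S)"
    using less.prems(1) by (auto simp: pair_graph_iff)
  show ?case
  proof (cases "\<forall>x\<in>pverts S. \<rho> x = x")
    case True
    have "{(\<rho> x, \<rho> y) | x y. (x, y) \<in> parcs S \<and> \<rho> x \<noteq> \<rho> y} = parcs S"
    proof -
      have "\<rho> x = x \<and> \<rho> y = y \<and> x \<noteq> y" if "(x, y) \<in> parcs S" for x y
        using that True S(2,3) by (auto simp: irrefl_def)
      then show ?thesis by force
    qed
    moreover have "\<rho> ` pverts S = pverts S" using True by simp
    ultimately have "?Q S = S" by (cases S) simp
    then show ?thesis by (simp add: contracts_to.refl)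
  next
    case False
    then obtain x where x: "x \<in> pverts S" "\<rho> x \<noteq> x" by blast
    define u where "u = \<rho> x"
    have u: "u \<in> pverts S" "\<rho> u = u" using less.prems(2)[OF x(1)] by (auto simp: u_def)
    have "x \<in> {y \<in> pverts S. \<rho> y = \<rho> x}" "x \<notin> {u}" using x by (auto simp: u_def)
    then have ne: "{u} \<noteq> {y \<in> pverts S. \<rho> y = \<rho> x}" by blast
    \<comment> \<open>Cutting the class at its representative \<open>u\<close> yields the edge to
      contract.\<close>
    have "\<exists>a\<in>{u}. \<exists>b\<in>{y \<in> pverts S. \<rho> y = \<rho> x} - {u}. (a, b) \<in> parcs S"
      by (rule conn_cut[OF less.prems(3)[OF x(1)]]) (use x u u_def ne in auto)
    then obtain v where v: "v \<in> pverts S" "\<rho> v = u" "v \<noteq> u" "(u, v) \<in> parcs S"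
      by (auto simp: u_def)
    define m where "m y = (if y = v then u else y)" for y
    define S1 where "S1 = contract_uedge S u v"
    have S1: "pverts S1 = m ` pverts S"
      "parcs S1 = {(m x, m y) | x y. (x, y) \<in> parcs S \<and> m x \<noteq> m y}"
      by (auto simp: S1_def contract_uedge_def Let_def m_def)
    have S1arc: "(m x, m y) \<in> parcs S1" if "(x, y) \<in> parcs S" "m x \<noteq> m y" for x y
      unfolding S1(2) by (rule CollectI, rule exI[of _ x], rule exI[of _ y]) (simp add: that)
    have \<rho>m: "\<rho> (m y) = \<rho> y" for y using u v by (simp add: m_def)
    have V1: "pverts S1 = pverts S - {v}" unfolding S1(1) using u(1) v(3) by (auto simp: m_def)
    have to: "contracts_to S1 (?Q S1)"
    proof (rule less.hyps)
      show "card (pverts S1) < card (pverts S)"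
        using V1 v(1) S(1) by (simp add: card_Diff1_less del: card_Diff_insert)
      show "pair_graph S1" unfolding S1_def by (rule pair_graph_contract_uedge) fact
      fix z assume z: "z \<in> pverts S1"
      then have zS: "z \<in> pverts S" using V1 by simp
      \<comment> \<open>The removed vertex \<open>v\<close> is not a representative, since
        \<open>\<rho> v = u\<close> differs from \<open>v\<close>.\<close>
      have "\<rho> z \<noteq> v" using less.prems(2)[OF zS] v by auto
      then show "\<rho> z \<in> pverts S1 \<and> \<rho> (\<rho> z) = \<rho> z" using less.prems(2)[OF zS] V1 by simp
      let ?X = "{y \<in> pverts S. \<rho> y = \<rho> z}"
      have "{y \<in> pverts S1. \<rho> y = \<rho> z} = m ` ?X"
        unfolding S1(1) using \<rho>m by auto
      moreover have "conn (parcs S1) (m ` ?X)"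
      proof (rule connI)
        show "m ` ?X \<noteq> {}" using zS by blast
        fix Y assume Y: "Y \<subseteq> m ` ?X" "Y \<noteq> {}" "Y \<noteq> m ` ?X"
        obtain a b where ab: "a \<in> {x \<in> ?X. m x \<in> Y}" "b \<in> ?X - {x \<in> ?X. m x \<in> Y}" "(a, b) \<in> parcs S"
          using conn_cut[OF less.prems(3)[OF zS], of "{x \<in> ?X. m x \<in> Y}"] Y by blast
        then have "m a \<in> Y" "m b \<in> m ` ?X - Y" by blast+
        moreover from this have ne: "m a \<noteq> m b" by (metis DiffE)
        then have "(m a, m b) \<in> parcs S1" by (rule S1arc[OF ab(3)])
        ultimately show "\<exists>a\<in>Y. \<exists>b\<in>m ` ?X - Y. (a, b) \<in> parcs S1" by blast
      qed
      ultimately show "conn (parcs S1) {y \<in> pverts S1. \<rho> y = \<rho> z}" by simp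
    qed
    have Q: "?Q S1 = ?Q S"
    proof -
      have "{(\<rho> x, \<rho> y) | x y. (x, y) \<in> parcs S1 \<and> \<rho> x \<noteq> \<rho> y} =
          {(\<rho> x, \<rho> y) | x y. (x, y) \<in> parcs S \<and> \<rho> x \<noteq> \<rho> y}"
      proof (intro equalityI subsetI)
        fix p assume "p \<in> {(\<rho> x, \<rho> y) | x y. (x, y) \<in> parcs S1 \<and> \<rho> x \<noteq> \<rho> y}"
        then obtain a b where "p = (\<rho> (m a), \<rho> (m b))" "(a, b) \<in> parcs S" "\<rho> (m a) \<noteq> \<rho> (m b)"
          unfolding S1(2) by blast
        then show "p \<in> {(\<rho> x, \<rho> y) | x y. (x, y) \<in> parcs S \<and> \<rho> x \<noteq> \<rho> y}"
          unfolding \<rho>m by blast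
      next
        fix p assume "p \<in> {(\<rho> x, \<rho> y) | x y. (x, y) \<in> parcs S \<and> \<rho> x \<noteq> \<rho> y}"
        then obtain a b where ab: "p = (\<rho> a, \<rho> b)" "(a, b) \<in> parcs S" "\<rho> a \<noteq> \<rho> b" by blast
        then have "m a \<noteq> m b" using \<rho>m by metis
        then have "(m a, m b) \<in> parcs S1" by (rule S1arc[OF ab(2)])
        moreover have "p = (\<rho> (m a), \<rho> (m b))" "\<rho> (m a) \<noteq> \<rho> (m b)" using ab by (simp_all add: \<rho>m)
        ultimately show "p \<in> {(\<rho> x, \<rho> y) | x y. (x, y) \<in> parcs S1 \<and> \<rho> x \<noteq> \<rho> y}" by blast
      qed
      moreover have "\<rho> ` pverts S1 = \<rho> ` pverts S"
        unfolding S1(1) image_image \<rho>m ..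
      ultimately show ?thesis by simp
    qed
    have "contracts_to S S1"
      unfolding S1_def by (rule contracts_to.step[OF contracts_to.refl v(4)])
    then show ?thesis unfolding Q[symmetric] by (rule contracts_to_trans[OF to])
  qed
qed

lemma pair_digraph_isoI:
  assumes "pair_graph M" "inj_on f (pverts M)"
    and H: "H = \<lparr>pverts = f ` pverts M, parcs = map_prod f f ` parcs M\<rparr>"
  shows "digraph_iso (with_proj M) (with_proj H)"
  unfolding digraph_iso_def
proof (intro exI conjI)
  let ?f = "\<lparr>iso_verts = f, iso_arcs = map_prod f f, iso_head = snd, iso_tail = fst\<rparr>"
  interpret pair_graph M by fact
  have "inj_on (map_prod f f) (parcs M)"
    using assms(2) by (intro inj_on_subset[OF map_prod_inj_on]) (auto dest: in_arcsD1 in_arcsD2)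
  then show "pre_digraph.digraph_isomorphism (with_proj M) ?f"
    unfolding pre_digraph.digraph_isomorphism_def using assms(2)
    by (auto intro: wf_digraph)
  show "with_proj H = app_iso ?f (with_proj M)"
    by (simp add: H app_iso_def with_proj_def)
qed

text \<open>Relabel the 9 vertices by \<open>{0..<9}\<close>. The image lies in K9 with 36 edges and
  has 30 of them, so the 6 edges to delete are exactly the missing ones.\<close>

lemma has_K_minus_minor_iso:
  assumes M: "pair_graph M" "card (pverts M) = 9" "card (parcs M) = 60"
    and S: "pair_graph S" "subgraph (with_proj S) (with_proj G)" "contracts_to S M"
  shows "has_K_minus_minor G 9 6"
proof -
  have M': "finite (pverts M)" "parcs M \<subseteq> pverts M \<times> pverts M" "sym (parcs M)" "irrefl (parcs M)"
    using M(1) by (auto simp: pair_graph_iff)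
  obtain f where f: "bij_betw f (pverts M) {0..<9::nat}"
    using ex_bij_betw_finite_nat[OF M'(1)] M(2) by auto
  then have inj: "inj_on f (pverts M)" and im: "f ` pverts M = {0..<9}" by (auto simp: bij_betw_def)
  define H where "H = \<lparr>pverts = f ` pverts M, parcs = map_prod f f ` parcs M\<rparr>"
  have iso: "digraph_iso (with_proj M) (with_proj H)"
    by (rule pair_digraph_isoI[OF M(1) inj H_def])
  define K where "K = \<lparr>pverts = {0..<9::nat}, parcs = {(u, v). u \<in> {0..<9} \<and> v \<in> {0..<9} \<and> u \<noteq> v}\<rparr>"
  have K: "complete_digraph 9 (with_proj K)" by (auto simp: complete_digraph_pair_def K_def)
  have pgK: "pair_graph K"
    unfolding pair_graph_iff K_def by (auto simp: sym_def irrefl_def)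
  have HK: "parcs H \<subseteq> parcs K"
  proof
    fix p assume "p \<in> parcs H"
    then obtain a b where ab: "p = (f a, f b)" "(a, b) \<in> parcs M" by (auto simp: H_def)
    then have "a \<in> pverts M" "b \<in> pverts M" "a \<noteq> b" using M' by (auto simp: irrefl_def)
    with ab im inj show "p \<in> parcs K" by (auto simp: K_def inj_on_eq_iff)
  qed
  have symH: "sym (parcs H)" using M'(3) unfolding H_def sym_def by auto
  have pgH: "pair_graph H"
    unfolding pair_graph_iff using symH HK im
    by (auto simp: irrefl_def H_def K_def)
  have "card (parcs H) = 60"
  proof -
    have "inj_on (map_prod f f) (parcs M)"
      using inj M'(2) by (intro inj_on_subset[OF map_prod_inj_on])
    then show ?thesis by (simp add: H_def card_image M(3))
  qed
  then have uH: "card (uedges H) = 30" using card_parcs_eq_twice_card_uedges[OF pgH] by simp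
  have "parcs K = {0..<9} \<times> {0..<9} - (\<lambda>x. (x, x)) ` {0..<9}" by (auto simp: K_def)
  then have "card (parcs K) = card ({0..<9::nat} \<times> {0..<9::nat}) - card ((\<lambda>x. (x, x)) ` {0..<9::nat})"
    by (simp only:) (rule card_Diff_subset, auto)
  also have "card ((\<lambda>x. (x, x)) ` {0..<9::nat}) = 9" by (simp add: card_image inj_on_def)
  finally have uK: "card (uedges K) = 36"
    using card_parcs_eq_twice_card_uedges[OF pgK] by (simp add: card_cartesian_product)
  have sub: "uedges H \<subseteq> uedges K" using HK by (auto simp: uedges_def)
  have "finite (uedges K)" using uK card.infinite by fastforce
  then have c6: "card (uedges K - uedges H) = 6"
    using uH uK sub by (simp add: card_Diff_subset finite_subset)
  have memH: "{u, v} \<in> uedges H \<longleftrightarrow> (u, v) \<in> parcs H" for u v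
    using symH by (auto simp: uedges_def doubleton_eq_iff dest: symD)
  have memK: "(u, v) \<in> parcs K \<Longrightarrow> {u, v} \<in> uedges K" for u v
    by (auto simp: uedges_def)
  have "delete_uedges K (uedges K - uedges H) = H"
  proof -
    have "{(u, v) \<in> parcs K. {u, v} \<notin> uedges K - uedges H} = parcs H"
      using memH memK HK by auto
    moreover have "pverts K = pverts H" using im by (simp add: K_def H_def)
    ultimately show ?thesis by (simp add: delete_uedges_def)
  qed
  then have "H \<in> K_minus 9 6"
    unfolding K_minus_def using K c6 by (intro CollectI exI[of _ K] exI[of _ "uedges K - uedges H"]) auto
  moreover have "has_minor G H" unfolding has_minor_def using S iso by blast
  ultimately show ?thesis unfolding has_K_minus_minor_def by blast
qed

text \<open>The choice is made among undirected edges and both arcs of each are kept; choosing arcs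
  directly would break symmetry.\<close>

lemma sgraph_subset_card:
  assumes "sgraph W F" "2 * k \<le> card F"
  obtains F' where "F' \<subseteq> F" "sgraph W F'" "card F' = 2 * k"
proof -
  let ?G = "\<lparr>pverts = W, parcs = F\<rparr>"
  have pg: "pair_graph ?G" using assms(1) by (simp add: pair_graph_sgraph)
  have "k \<le> card (uedges ?G)" using card_parcs_eq_twice_card_uedges[OF pg] assms(2) by simp
  then obtain U where U: "U \<subseteq> uedges ?G" "card U = k" by (meson obtain_subset_with_card_n)
  define F' where "F' = {(a, b) \<in> F. {a, b} \<in> U}"
  have sg: "sgraph W F'"
    using assms(1) unfolding sgraph_def F'_def sym_def irrefl_def by (auto simp: insert_commute)
  have "uedges \<lparr>pverts = W, parcs = F'\<rparr> = U"
    using U(1) unfolding uedges_def F'_def by fastforce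
  then have "card F' = 2 * k"
    using card_parcs_eq_twice_card_uedges[of "\<lparr>pverts = W, parcs = F'\<rparr>"] sg U(2)
    by (simp add: pair_graph_sgraph)
  with sg show ?thesis by (intro that[of F']) (auto simp: F'_def)
qed

text \<open>Exactly 6 edges must be missing, so the bag model is first trimmed to 60 arcs and then
  realised by contracting a subgraph in which no other adjacencies between bags survive.\<close>

lemma good_imp_has_K_minus_minor:
  assumes G: "pair_graph G" and "good (pverts G) (parcs G)"
  shows "has_K_minus_minor G 9 6"
proof -
  obtain W F0 where WF0: "minor (pverts G) (parcs G) W F0" "sgraph W F0" "card W = 9" "60 \<le> card F0"
    using assms(2) unfolding good_def by blast
  obtain F where F: "F \<subseteq> F0" "sgraph W F" "card F = 60"
    using sgraph_subset_card[OF WF0(2), of 30] WF0(4) by auto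
  obtain B where B: "\<And>w. w \<in> W \<Longrightarrow> B w \<subseteq> pverts G" "\<And>w. w \<in> W \<Longrightarrow> conn (parcs G) (B w)"
    "\<And>w w'. w \<in> W \<Longrightarrow> w' \<in> W \<Longrightarrow> w \<noteq> w' \<Longrightarrow> B w \<inter> B w' = {}"
    "\<And>w w'. (w, w') \<in> F \<Longrightarrow> \<exists>a\<in>B w. \<exists>b\<in>B w'. (a, b) \<in> parcs G"
    by (rule minorE[OF minor_mono[OF WF0(1) F(1)]]) (rule that)
  have F': "F \<subseteq> W \<times> W" "sym F" "irrefl F" using F(2) by (auto simp: sgraph_def)
  have G': "finite (pverts G)" "sym (parcs G)" "irrefl (parcs G)" "parcs G \<subseteq> pverts G \<times> pverts G"
    using G by (auto simp: pair_graph_iff)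
  define r where "r w = (SOME x. x \<in> B w)" for w
  have r: "r w \<in> B w" if "w \<in> W" for w
    unfolding r_def using conn_nonempty[OF B(2)[OF that]] by (simp add: some_in_eq)
  define wh where "wh x = (THE w. w \<in> W \<and> x \<in> B w)" for x
  have wh: "wh x = w" if "w \<in> W" "x \<in> B w" for w x
    unfolding wh_def using that B(3) by (intro the_equality) blast+
  \<comment> \<open>Arcs inside a bag are kept so that the bag can be contracted. Arcs between
    different bags are kept only for pairs in \<open>F\<close>, so the quotient is exactly
    \<open>F\<close>.\<close>
  define S where "S = \<lparr>pverts = (\<Union>w\<in>W. B w), parcs = {(a, b) \<in> parcs G. \<exists>w\<in>W. \<exists>w'\<in>W.
     a \<in> B w \<and> b \<in> B w' \<and> (w = w' \<or> (w, w') \<in> F)}\<rparr>"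
  have pvS: "pverts S = (\<Union>w\<in>W. B w)" by (simp add: S_def)
  have arcS: "(a, b) \<in> parcs S \<longleftrightarrow> (a, b) \<in> parcs G \<and> (\<exists>w\<in>W. \<exists>w'\<in>W.
     a \<in> B w \<and> b \<in> B w' \<and> (w = w' \<or> (w, w') \<in> F))" for a b by (auto simp: S_def)
  have "finite (pverts S)" unfolding pvS using B(1) G'(1) by (meson UN_least finite_subset)
  moreover have "sym (parcs S)"
    using G'(2) F'(2) by (intro symI) (auto simp: arcS dest: symD)
  moreover have "parcs S \<subseteq> pverts S \<times> pverts S" unfolding pvS by (auto simp: arcS)
  moreover have "irrefl (parcs S)" using G'(3) by (auto simp: irrefl_def arcS)
  ultimately have pgS: "pair_graph S" unfolding pair_graph_iff by blast
  define \<rho> where "\<rho> x = r (wh x)" for x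
  have \<rho>: "\<rho> x = r w" if "w \<in> W" "x \<in> B w" for w x using wh[OF that] by (simp add: \<rho>_def)
  have rinj: "r w = r w' \<longleftrightarrow> w = w'" if "w \<in> W" "w' \<in> W" for w w'
    using r[OF that(1)] r[OF that(2)] wh that by metis
  define M where "M = \<lparr>pverts = \<rho> ` pverts S, parcs = {(\<rho> x, \<rho> y) | x y. (x, y) \<in> parcs S \<and> \<rho> x \<noteq> \<rho> y}\<rparr>"
  have cM: "contracts_to S M" unfolding M_def
  proof (rule contracts_to_quotient[OF pgS])
    fix x assume "x \<in> pverts S"
    then obtain w where w: "w \<in> W" "x \<in> B w" by (auto simp: pvS)
    then show "\<rho> x \<in> pverts S \<and> \<rho> (\<rho> x) = \<rho> x"
      using \<rho> r[OF w(1)] by (auto simp: pvS)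
    have eq: "{y \<in> pverts S. \<rho> y = \<rho> x} = B w"
      using \<rho> rinj w by (auto simp: pvS)
    show "conn (parcs S) {y \<in> pverts S. \<rho> y = \<rho> x}"
      unfolding eq by (rule conn_mono[OF B(2)[OF w(1)]]) (use w(1) arcS in blast)
  qed
  have "pverts M = r ` W" unfolding M_def pvS using \<rho> r by (auto simp: image_iff) metis+
  then have c9: "card (pverts M) = 9"
    using rinj WF0(3) by (simp add: card_image inj_on_def)
  have "parcs M = map_prod r r ` F"
  proof (intro equalityI subsetI)
    fix p assume "p \<in> parcs M"
    then obtain x y where xy: "p = (\<rho> x, \<rho> y)" "(x, y) \<in> parcs S" "\<rho> x \<noteq> \<rho> y" by (auto simp: M_def)
    then obtain w w' where "w \<in> W" "w' \<in> W" "x \<in> B w" "y \<in> B w'" "w = w' \<or> (w, w') \<in> F"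
      by (auto simp: arcS)
    with xy \<rho> show "p \<in> map_prod r r ` F" by force
  next
    fix p assume "p \<in> map_prod r r ` F"
    then obtain w w' where ww: "p = (r w, r w')" "(w, w') \<in> F" by auto
    then obtain a b where ab: "a \<in> B w" "b \<in> B w'" "(a, b) \<in> parcs G" using B(4) by blast
    have W: "w \<in> W" "w' \<in> W" "w \<noteq> w'" using ww(2) F' by (auto simp: irrefl_def)
    then have "(a, b) \<in> parcs S" using ww ab by (auto simp: arcS)
    moreover have "\<rho> a = r w" "\<rho> b = r w'" using \<rho> W ab by auto
    ultimately show "p \<in> parcs M" using ww(1) rinj[OF W(1,2)] W(3) by (force simp: M_def)
  qed
  moreover have "inj_on (map_prod r r) F"
    using rinj F'(1) by (intro inj_on_subset[OF map_prod_inj_on]) (auto simp: inj_on_def)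
  ultimately have c60: "card (parcs M) = 60" using F(3) by (simp add: card_image)
  have "subgraph (with_proj S) (with_proj G)"
  proof -
    interpret S: pair_graph S by fact
    interpret G: pair_graph G by fact
    show ?thesis unfolding subgraph_def
      using B(1) by (auto simp: pvS arcS intro: S.wf_digraph G.wf_digraph)
  qed
  then show ?thesis
    using has_K_minus_minor_iso[OF pair_graph_contracts_to[OF cM pgS] c9 c60 pgS _ cM] by blast
qed

section \<open>A minimal counterexample\<close>

lemma sgraph_card_even: "sgraph V E \<Longrightarrow> even (card E)"
  using card_parcs_eq_twice_card_uedges[of "\<lparr>pverts = V, parcs = E\<rparr>"] by (simp add: pair_graph_sgraph)

lemma good_minor:
  assumes "minor V E W F" "good W F"
  shows "good V E"
proof -
  obtain X H where "minor W F X H" "sgraph X H" "card X = 9" "60 \<le> card H"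
    using assms(2) by (auto simp: good_def)
  moreover from this have "minor V E X H"
    using minor_trans[OF assms(1)] by (auto simp: sgraph_def)
  ultimately show ?thesis unfolding good_def by blast
qed

lemma card_two_distinct:
  assumes "2 \<le> card X"
  obtains x y where "x \<in> X" "y \<in> X" "x \<noteq> y"
proof -
  obtain T where "T \<subseteq> X" "card T = 2" using assms by (meson obtain_subset_with_card_n)
  then show ?thesis using that by (auto simp: card_2_iff)
qed

lemma card_Int_ge:
  assumes "finite H" "X \<subseteq> H" "Y \<subseteq> H"
  shows "card X + card Y \<le> card H + card (X \<inter> Y)"
proof -
  have "finite X" "finite Y" using assms finite_subset by auto
  then have "card X + card Y = card (X \<union> Y) + card (X \<inter> Y)" by (rule card_Un_Int)
  moreover have "card (X \<union> Y) \<le> card H" using assms by (intro card_mono) auto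
  ultimately show ?thesis by simp
qed

text \<open>In \<open>minor_le\<close> the constant is 30 rather than 29 because arc numbers are
  even. With at least 10 vertices, removing one still leaves the range in which
  \<open>minor_le\<close> speaks.\<close>

locale min_counterexample =
  fixes V :: "'a set" and E :: "'a rel"
  assumes sgraph: "sgraph V E"
    and card_V: "10 \<le> card V"
    and card_E: "card E + 28 = 10 * card V"
    and bad: "\<not> good V E"
    and minor_le: "\<And>W F. minor V E W F \<Longrightarrow> sgraph W F \<Longrightarrow> 9 \<le> card W \<Longrightarrow>
      card W < card V \<Longrightarrow> card F + 30 \<le> 10 * card W"
begin

abbreviation nb :: "'a \<Rightarrow> 'a set" where "nb x \<equiv> E `` {x}"
abbreviation cnb :: "'a \<Rightarrow> 'a set" where "cnb x \<equiv> insert x (nb x)"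
abbreviation dg :: "'a set \<Rightarrow> 'a \<Rightarrow> nat" where "dg A x \<equiv> card (nb x \<inter> A)"

text \<open>\<open>ar A\<close> counts arcs, so it is twice the number of edges and all edge bounds appear doubled.\<close>

definition ar :: "'a set \<Rightarrow> nat" where "ar A = card (E \<inter> A \<times> A)"

lemma finite_V: "finite V" and E_subset: "E \<subseteq> V \<times> V"
  using sgraph by (auto simp: sgraph_def)

lemma E_sym: "(x, y) \<in> E \<Longrightarrow> (y, x) \<in> E" and E_irrefl [simp]: "(x, x) \<notin> E"
  using sgraph by (auto simp: sgraph_def sym_def irrefl_def)

lemma sym_E: "sym E"
  using E_sym by (auto intro: symI)

lemma finite_E: "finite E"
  using finite_V E_subset by (meson finite_SigmaI finite_subset)

lemma nb_subset: "E `` X \<subseteq> V"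
  using E_subset by blast

lemma finite_sub [simp]: "X \<subseteq> V \<Longrightarrow> finite X"
  using finite_V finite_subset by blast

lemma finite_nb [simp]: "finite (E `` X)"
  using nb_subset by (rule finite_sub)

section \<open>Counting arcs in induced subgraphs\<close>

lemma ar_sum: "finite A \<Longrightarrow> ar A = (\<Sum>x\<in>A. dg A x)"
proof -
  assume "finite A"
  moreover have "E \<inter> A \<times> A = Sigma A (\<lambda>x. nb x \<inter> A)" by auto
  ultimately show ?thesis by (simp add: ar_def)
qed

lemma ar_even: "A \<subseteq> V \<Longrightarrow> even (ar A)"
  unfolding ar_def using sgraph_card_even[OF sgraph_Int[OF sgraph]] .

lemma ar_insert: "finite A \<Longrightarrow> x \<notin> A \<Longrightarrow> ar (insert x A) = ar A + 2 * dg A x"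
proof -
  assume "finite A" "x \<notin> A"
  then have "card (attach E A x (nb x)) = ar A + 2 * dg A x"
    unfolding ar_def by (rule card_attach)
  moreover have "attach E A x (nb x) = E \<inter> insert x A \<times> insert x A"
    unfolding attach_def by (auto intro: E_sym)
  ultimately show ?thesis by (simp add: ar_def)
qed

lemma dg_le:
  assumes "finite A" "x \<in> A"
  shows "dg A x \<le> card A - 1"
proof -
  have "nb x \<inter> A \<subseteq> A - {x}" by auto
  then have "dg A x \<le> card (A - {x})" using assms(1) by (intro card_mono) auto
  then show ?thesis using assms by simp
qed

lemma ar_ge: "finite A \<Longrightarrow> (\<And>x. x \<in> A \<Longrightarrow> m \<le> dg A x) \<Longrightarrow> m * card A \<le> ar A"
  using sum_bounded_below[of A m "dg A"] by (simp add: ar_sum mult.commute)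

lemma ar_le: "finite A \<Longrightarrow> ar A \<le> card A * (card A - 1)"
  using sum_bounded_above[of A "dg A" "card A - 1"] dg_le by (simp add: ar_sum)

lemma ar_clique:
  assumes "finite A" "\<And>a b. a \<in> A \<Longrightarrow> b \<in> A \<Longrightarrow> a \<noteq> b \<Longrightarrow> (a, b) \<in> E"
  shows "ar A = card A * (card A - 1)"
proof -
  have "dg A x = card A - 1" if "x \<in> A" for x
  proof -
    have "nb x \<inter> A = A - {x}" using assms(2) that by auto
    then show ?thesis using that assms(1) by simp
  qed
  then show ?thesis using assms(1) by (simp add: ar_sum)
qed

text \<open>Inclusion and exclusion: no edge crosses, so each lies in \<open>A\<close> or in
  \<open>B\<close>, and those in both lie in the middle.\<close>

lemma ar_separation:
  assumes "A \<union> B = V" "E \<inter> (A - B) \<times> (B - A) = {}"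
  shows "card E + ar (A \<inter> B) = ar A + ar B"
proof -
  have "E = E \<inter> A \<times> A \<union> E \<inter> B \<times> B"
  proof
    show "E \<subseteq> E \<inter> A \<times> A \<union> E \<inter> B \<times> B"
    proof (rule subrelI)
      fix x y assume "(x, y) \<in> E"
      then have "x \<in> V" "y \<in> V" "(x, y) \<in> E" "(y, x) \<in> E" using E_subset E_sym by auto
      then show "(x, y) \<in> E \<inter> A \<times> A \<union> E \<inter> B \<times> B" using assms by blast
    qed
  qed blast
  moreover have "E \<inter> (A \<inter> B) \<times> (A \<inter> B) = (E \<inter> A \<times> A) \<inter> (E \<inter> B \<times> B)" by blast
  moreover have "finite (E \<inter> A \<times> A)" "finite (E \<inter> B \<times> B)" using finite_E by auto
  ultimately show ?thesis unfolding ar_def by (metis card_Un_Int)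
qed

section \<open>Upper bounds forced by minimality and by the absence of the minor\<close>

lemma minor9_le:
  assumes "minor V E W F" "sgraph W F" "card W = 9"
  shows "card F \<le> 58"
proof (rule ccontr)
  assume "\<not> card F \<le> 58"
  then have "60 \<le> card F" using sgraph_card_even[OF assms(2)] by presburger
  with assms bad show False unfolding good_def by blast
qed

lemma ar_bound: "A \<subseteq> V \<Longrightarrow> 9 \<le> card A \<Longrightarrow> card A < card V \<Longrightarrow> ar A + 30 \<le> 10 * card A"
  unfolding ar_def by (intro minor_le minor_sub sgraph_Int[OF sgraph]) auto

lemma ar_bound9: "A \<subseteq> V \<Longrightarrow> card A = 9 \<Longrightarrow> ar A \<le> 58"
  unfolding ar_def by (rule minor9_le[OF minor_sub sgraph_Int[OF sgraph]]) auto

text \<open>K7 and K8 violate the bound with 30. The constant 24 = 80 - 56 comes from K8 and also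
  covers K7, where 42 is at most 46.\<close>

lemma ar_bound7:
  assumes "A \<subseteq> V" "7 \<le> card A" "card A < card V"
  shows "ar A + 24 \<le> 10 * card A"
proof -
  consider "card A = 7" | "card A = 8" | "9 \<le> card A" using assms(2) by linarith
  then show ?thesis
    using ar_le[OF finite_sub[OF assms(1)]] ar_bound[OF assms(1)] assms(3) by cases auto
qed

lemma minor_attach_C:
  assumes "A \<subseteq> V" "C \<subseteq> V" "conn E C" "A \<inter> C = {}" "c \<in> C"
  shows "minor V E (insert c A) (attach E A c (E `` C))"
    "sgraph (insert c A) (attach E A c (E `` C))"
    "card (attach E A c (E `` C)) = ar A + 2 * card (E `` C \<inter> A)"
proof -
  show "minor V E (insert c A) (attach E A c (E `` C))"
    using minor_attach[OF sgraph] assms by blast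
  show "sgraph (insert c A) (attach E A c (E `` C))"
    using sgraph_attach[OF sgraph] assms by blast
  show "card (attach E A c (E `` C)) = ar A + 2 * card (E `` C \<inter> A)"
    unfolding ar_def using assms by (intro card_attach) auto
qed

lemma attach_bound:
  assumes "A \<subseteq> V" "C \<subseteq> V" "conn E C" "A \<inter> C = {}" "card A = 8"
  shows "ar A + 2 * card (E `` C \<inter> A) \<le> 58"
proof -
  obtain c where c: "c \<in> C" using conn_nonempty[OF assms(3)] by blast
  have "card (insert c A) = 9"
    using c assms(1,4,5) finite_sub[of A] by (subst card_insert_disjoint) auto
  then show ?thesis using minor9_le minor_attach_C[OF assms(1-4) c] by metis
qed

text \<open>\<open>C\<close> is contracted to a vertex and that vertex into \<open>y\<close>, so the
  vertex set stays \<open>A\<close>. The gain is the number of neighbours of \<open>C\<close> in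
  \<open>A\<close>, less \<open>y\<close> itself and those already adjacent to
  \<open>y\<close>.\<close>

lemma absorb_minor:
  assumes "A \<subseteq> V" "C \<subseteq> V" "conn E C" "A \<inter> C = {}" "y \<in> E `` C \<inter> A"
  obtains F where "minor V E A F" "sgraph A F"
    "card F + 2 + 2 * card (nb y \<inter> (E `` C \<inter> A)) = ar A + 2 * card (E `` C \<inter> A)"
proof -
  obtain c where c: "c \<in> C" using conn_nonempty[OF assms(3)] by blast
  have cA: "c \<notin> A" using c assms(4) by blast
  define F1 where "F1 = attach E A c (E `` C)"
  note F1 = minor_attach_C[OF assms(1-4) c, folded F1_def]
  have yc: "(y, c) \<in> F1" using assms(5) by (auto simp: F1_def attach_def)
  have W: "insert c A - {c} = A" using cA by simp
  have "F1 `` {y} \<inter> F1 `` {c} = nb y \<inter> (E `` C \<inter> A)"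
    using assms(5) cA by (auto simp: F1_def attach_def)
  then have "card (contr F1 y c) + 2 + 2 * card (nb y \<inter> (E `` C \<inter> A)) = card F1"
    using card_contr[OF F1(2) yc] by simp
  moreover have s: "sgraph A (contr F1 y c)" using sgraph_contr[OF F1(2) yc] W by simp
  moreover have "minor V E A (contr F1 y c)"
    using minor_trans[OF F1(1) minor_contr[OF F1(2) yc]] s W by (simp add: sgraph_def)
  ultimately show ?thesis using that F1(3) by simp
qed

lemma absorb_bound:
  assumes "A \<subseteq> V" "C \<subseteq> V" "conn E C" "A \<inter> C = {}" "y \<in> E `` C \<inter> A" "9 \<le> card A"
  shows "ar A + 2 * card (E `` C \<inter> A) + 28 \<le> 10 * card A + 2 * card (nb y \<inter> (E `` C \<inter> A))"
proof -
  obtain F where F: "minor V E A F" "sgraph A F"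
    "card F + 2 + 2 * card (nb y \<inter> (E `` C \<inter> A)) = ar A + 2 * card (E `` C \<inter> A)"
    using absorb_minor[OF assms(1-5)] by blast
  have "A \<subset> V" using assms(1,2,4) conn_nonempty[OF assms(3)] by blast
  then have "card A < card V" by (intro psubset_card_mono finite_V)
  from minor_le[OF F(1,2) assms(6) this] F(3) show ?thesis by linarith
qed

lemma absorb_bound9:
  assumes "A \<subseteq> V" "C \<subseteq> V" "conn E C" "A \<inter> C = {}" "y \<in> E `` C \<inter> A" "card A = 9"
  shows "ar A + 2 * card (E `` C \<inter> A) \<le> 60 + 2 * card (nb y \<inter> (E `` C \<inter> A))"
proof -
  obtain F where F: "minor V E A F" "sgraph A F"
    "card F + 2 + 2 * card (nb y \<inter> (E `` C \<inter> A)) = ar A + 2 * card (E `` C \<inter> A)"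
    using absorb_minor[OF assms(1-5)] by blast
  from minor9_le[OF F(1,2) assms(6)] F(3) show ?thesis by linarith
qed

section \<open>Triangles, degrees, and the separation given by a component\<close>

lemma edge_triangles:
  assumes "(u, v) \<in> E"
  shows "5 \<le> card (nb u \<inter> nb v)"
proof -
  have v: "v \<in> V" using assms E_subset by blast
  have "card (contr E u v) + 30 \<le> 10 * card (V - {v})"
    using v card_V by (intro minor_le minor_contr[OF sgraph assms] sgraph_contr[OF sgraph assms])
      (auto simp: card_Diff_singleton)
  then show ?thesis using card_contr[OF sgraph assms] card_E v card_V by simp
qed

lemma min_degree:
  assumes "x \<in> V"
  shows "6 \<le> card (nb x)"
proof -
  have "ar (insert x (V - {x})) = ar (V - {x}) + 2 * dg (V - {x}) x"
    using finite_V by (intro ar_insert) auto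
  moreover have "insert x (V - {x}) = V" using assms by blast
  moreover have "nb x \<inter> (V - {x}) = nb x" using nb_subset by auto
  moreover have "ar V = card E" unfolding ar_def using E_subset by (simp add: Int_absorb2)
  moreover have "ar (V - {x}) + 30 \<le> 10 * card (V - {x})"
    using assms card_V finite_V by (intro ar_bound) auto
  ultimately show ?thesis using card_E assms card_V by simp
qed

lemma dg_nb:
  assumes "y \<in> nb v"
  shows "5 \<le> dg (nb v) y"
  using edge_triangles[of y v] assms E_sym by auto

lemma ar_cnb: "ar (cnb v) = ar (nb v) + 2 * card (nb v)"
  using ar_insert[of "nb v" v] by simp

lemma cnb_subset: "v \<in> V \<Longrightarrow> cnb v \<subseteq> V"
  using nb_subset by blast

text \<open>All facts concern the separation with sides \<open>C \<union> S\<close> and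
  \<open>V - C\<close> and middle \<open>S\<close>. The first side has at least 7 vertices because
  it contains the closed neighbourhood of any vertex of \<open>C\<close>; the second contains
  \<open>cnb v\<close>.\<close>

lemma component_sep:
  assumes v: "v \<in> V" and C: "component E (V - cnb v) C" and S: "S = E `` C \<inter> nb v"
  shows "C \<subseteq> V" "conn E C" "C \<inter> cnb v = {}" "E `` C \<subseteq> C \<union> S" "v \<notin> E `` C"
    "card E + ar S = ar (C \<union> S) + ar (V - C)"
    "card (C \<union> S) + card (V - C) = card V + card S"
    "7 \<le> card (C \<union> S)" "cnb v \<subseteq> V - C" "C \<union> S \<subseteq> V - {v}"
proof -
  show CV: "C \<subseteq> V" and cC: "conn E C" and Cc: "C \<inter> cnb v = {}"
    using C by (auto simp: component_def)
  show v': "v \<notin> E `` C" using Cc by (auto intro: E_sym)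
  have "E `` C \<subseteq> C \<union> nb v"
    using C nb_subset[of C] v' unfolding component_def by blast
  then show EC: "E `` C \<subseteq> C \<union> S" unfolding S by blast
  have SV: "S \<subseteq> V" "C \<inter> S = {}" using S nb_subset Cc by auto
  have "(C \<union> S) \<union> (V - C) = V" "(C \<union> S) \<inter> (V - C) = S" using CV SV by auto
  moreover have "E \<inter> (C \<union> S - (V - C)) \<times> (V - C - (C \<union> S)) = {}" using EC SV CV by blast
  ultimately show "card E + ar S = ar (C \<union> S) + ar (V - C)"
    using ar_separation[of "C \<union> S" "V - C"] by simp
  have "card (C \<union> S) = card C + card S"
    using CV SV by (intro card_Un_disjoint) auto
  moreover have "card (V - C) = card V - card C" "card C \<le> card V"
    using CV by (auto simp: card_Diff_subset card_mono finite_V)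
  ultimately show "card (C \<union> S) + card (V - C) = card V + card S" by simp
  obtain c where c: "c \<in> C" using conn_nonempty[OF cC] by blast
  then have "cnb c \<subseteq> C \<union> S" using EC by blast
  then have "card (cnb c) \<le> card (C \<union> S)" using CV SV by (intro card_mono) auto
  then show "7 \<le> card (C \<union> S)" using min_degree[of c] c CV by auto
  show "cnb v \<subseteq> V - C" using cnb_subset[OF v] Cc by blast
  show "C \<union> S \<subseteq> V - {v}" using CV SV Cc S by auto
qed


subsection \<open>Neighbourhoods of size 7, 8 and 9\<close>

text \<open>Exactly the vertices of \<open>nb v\<close> that lack an edge inside \<open>nb v\<close>
  are required to see \<open>C\<close>. Contracting \<open>C\<close> into such a vertex therefore
  makes it adjacent to all of \<open>nb v\<close>.\<close>

definition full_component :: "'a \<Rightarrow> 'a set \<Rightarrow> bool" where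
  "full_component v C \<longleftrightarrow> component E (V - cnb v) C \<and>
     (\<forall>y\<in>nb v. \<forall>z\<in>nb v. y \<noteq> z \<longrightarrow> (y, z) \<notin> E \<longrightarrow> y \<in> E `` C)"

lemma full_componentD:
  assumes "full_component v C"
  shows "component E (V - cnb v) C"
    "y \<in> nb v \<Longrightarrow> z \<in> nb v \<Longrightarrow> y \<noteq> z \<Longrightarrow> (y, z) \<notin> E \<Longrightarrow> y \<in> E `` C"
  using assms unfolding full_component_def by blast+

text \<open>\<open>M\<close> collects the vertices with one missing edge in \<open>nb v\<close>;
  fullness puts it inside \<open>S\<close>. Attaching \<open>C\<close> to \<open>cnb v\<close> gives
  9 vertices and forces \<open>card S\<close> to be at most 2, while counting across the separation
  forces at least 2, and the remaining case fails by two arcs.\<close>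

lemma full_component_7:
  assumes v: "v \<in> V" "card (nb v) = 7" and full: "full_component v C"
  shows False
proof -
  define S where "S = E `` C \<inter> nb v"
  note sep = component_sep[OF v(1) full_componentD(1)[OF full] S_def]
  define M where "M = {y \<in> nb v. dg (nb v) y = 5}"
  have dg: "dg (nb v) y = 6 - (if y \<in> M then 1 else 0)" if "y \<in> nb v" for y
    using dg_nb[OF that] dg_le[of "nb v" y] that v(2) by (auto simp: M_def)
  have "M \<subseteq> nb v" by (auto simp: M_def)
  then have finM: "finite M" "M \<subseteq> nb v" using finite_subset[OF _ finite_nb] by auto
  have "ar (nb v) + card M = (\<Sum>y\<in>nb v. 6 - (if y \<in> M then 1 else 0)) + (\<Sum>y\<in>nb v. if y \<in> M then 1 else 0)"
    using finM dg by (simp add: ar_sum sum.If_cases Int_absorb1)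
  also have "\<dots> = (\<Sum>y\<in>nb v. 6)"
    by (subst sum.distrib[symmetric]) (auto intro: sum.cong)
  finally have arH: "ar (nb v) + card M = 42" using v(2) by simp
  have "M \<subseteq> S"
  proof
    fix y assume y: "y \<in> M"
    then have yH: "y \<in> nb v" "dg (nb v) y = 5" by (auto simp: M_def)
    have "\<not> nb v - {y} \<subseteq> nb y \<inter> nb v"
    proof
      assume "nb v - {y} \<subseteq> nb y \<inter> nb v"
      then have "card (nb v - {y}) \<le> dg (nb v) y" by (intro card_mono) auto
      then show False using yH v(2) by simp
    qed
    then show "y \<in> S" using full_componentD(2)[OF full] yH(1) unfolding S_def by blast
  qed
  then have MS: "card M \<le> card S" by (intro card_mono) (auto simp: S_def)
  have A: "cnb v \<subseteq> V" "card (cnb v) = 8" "cnb v \<inter> C = {}" "E `` C \<inter> cnb v = S"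
    using cnb_subset[OF v(1)] v(2) sep(3,5) by (auto simp: S_def)
  have "ar (cnb v) + 2 * card S \<le> 58"
    using attach_bound[OF A(1) sep(1,2) A(3,2)] A(4) by simp
  \<comment> \<open>\<open>cnb v\<close> has 42 - \<open>card M\<close> + 14 arcs, and the attached
    vertex must not raise this above 58.\<close>
  then have s2: "2 * card S \<le> 2 + card M" using ar_cnb[of v] arH v(2) by simp
  have "C \<noteq> {}" using sep(2) conn_nonempty by blast
  have lt: "card (C \<union> S) < card V" "card (V - C) < card V"
    using sep(1,10) v(1) \<open>C \<noteq> {}\<close> by (auto intro!: psubset_card_mono finite_V)
  have bA: "ar (C \<union> S) + 24 \<le> 10 * card (C \<union> S)"
    using sep(8,10) lt by (intro ar_bound7) auto
  have c8: "8 \<le> card (V - C)"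
    using card_mono[OF _ sep(9)] A(2) finite_V by simp
  have bB: "ar (V - C) + 24 \<le> 10 * card (V - C)"
    using c8 lt by (intro ar_bound7) auto
  have "2 \<le> card S" using bA bB sep(6,7) card_E by linarith
  then have s: "card S = 2" "card M = 2" using s2 MS by linarith+
  have "ar (V - C) + 26 \<le> 10 * card (V - C)"
  proof (cases "card (V - C) = 8")
    case True
    then have "cnb v = V - C"
      using sep(9) A(2) by (intro card_subset_eq) (auto simp: finite_V)
    \<comment> \<open>With two vertices of degree 5 in \<open>nb v\<close>, the set
      \<open>cnb v\<close> has 40 + 14 arcs, two fewer than the general bound for 8
      vertices.\<close>
    then have "ar (V - C) = 54" using ar_cnb[of v] arH s v(2) by simp
    with True show ?thesis by simp
  next
    case False
    then show ?thesis using c8 lt(2) ar_bound[of "V - C"] by simp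
  qed
  then show False using bA sep(6,7) card_E s by linarith
qed

text \<open>The vertex \<open>z\<close> and all its non-neighbours in \<open>nb v\<close> lie in the
  neighbourhood of \<open>C\<close>. The equation counts this common set of non-neighbours inside
  both sets; it measures the gain from contracting \<open>C\<close> into \<open>z\<close>.\<close>

lemma full_component_nonnb:
  assumes full: "full_component v C"
    and z: "z \<in> nb v" "dg (nb v) z + 1 < card (nb v)"
  shows "z \<in> E `` C"
    "card (E `` C \<inter> nb v) + dg (nb v) z = card (nb z \<inter> (E `` C \<inter> nb v)) + card (nb v)"
proof -
  have "\<not> nb v - {z} \<subseteq> nb z \<inter> nb v"
  proof
    assume "nb v - {z} \<subseteq> nb z \<inter> nb v"
    then have "card (nb v - {z}) \<le> dg (nb v) z" by (intro card_mono) auto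
    then show False using z by simp
  qed
  then show zC: "z \<in> E `` C" using full_componentD(2)[OF full] z(1) by blast
  have eq: "E `` C \<inter> nb v - nb z = nb v - nb z"
    using full_componentD(2)[OF full, of _ z] z(1) zC by (auto intro: E_sym)
  have "card (X \<inter> nb v) = card (nb z \<inter> (X \<inter> nb v)) + card (X \<inter> nb v - nb z)" for X
  proof -
    have "card (X \<inter> nb v) = card ((nb z \<inter> (X \<inter> nb v)) \<union> (X \<inter> nb v - nb z))"
      by (rule arg_cong[of _ _ card]) blast
    also have "\<dots> = card (nb z \<inter> (X \<inter> nb v)) + card (X \<inter> nb v - nb z)"
      by (intro card_Un_disjoint) auto
    finally show ?thesis .
  qed
  from this[of "E `` C"] this[of UNIV] eq
  show "card (E `` C \<inter> nb v) + dg (nb v) z = card (nb z \<inter> (E `` C \<inter> nb v)) + card (nb v)"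
    by simp
qed

text \<open>\<open>cnb v\<close> already has 9 vertices, so its bound of 58 arcs forces some
  \<open>z\<close> of degree 5 in \<open>nb v\<close>. Contracting \<open>C\<close> into
  \<open>z\<close> gains the two edges that \<open>z\<close> lacks there, turning at least 56 arcs
  into at least 60.\<close>

lemma full_component_8:
  assumes v: "v \<in> V" "card (nb v) = 8" and full: "full_component v C"
  shows False
proof -
  note sep = component_sep[OF v(1) full_componentD(1)[OF full] HOL.refl]
  have A: "cnb v \<subseteq> V" "card (cnb v) = 9" "cnb v \<inter> C = {}" "E `` C \<inter> cnb v = E `` C \<inter> nb v"
    using cnb_subset[OF v(1)] v(2) sep(3,5) by auto
  have arH: "ar (nb v) \<le> 42" using ar_bound9[OF A(1,2)] ar_cnb[of v] v(2) by simp
  have "\<not> (\<forall>z\<in>nb v. 6 \<le> dg (nb v) z)"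
    using ar_ge[of "nb v" 6] arH v(2) by auto
  then obtain z where z: "z \<in> nb v" "\<not> 6 \<le> dg (nb v) z" by blast
  then have z5: "dg (nb v) z = 5" using dg_nb[OF z(1)] by linarith
  have fz: "z \<in> E `` C" "card (E `` C \<inter> nb v) + 5 = card (nb z \<inter> (E `` C \<inter> nb v)) + 8"
    using full_component_nonnb[OF full, of z] z(1) z5 v(2) by simp_all
  have "ar (cnb v) + 2 * card (E `` C \<inter> nb v) \<le> 60 + 2 * card (nb z \<inter> (E `` C \<inter> nb v))"
    using absorb_bound9[OF A(1) sep(1,2) A(3) _ A(2), of z] fz(1) z(1) A(4) by simp
  moreover have "40 \<le> ar (nb v)" using ar_ge[of "nb v" 5] dg_nb[of _ v] v(2) by simp
  ultimately show False using fz(2) ar_cnb[of v] v(2) by simp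
qed

text \<open>The minor is \<open>nb v\<close> after contracting \<open>C\<close> into \<open>z\<close> and \<open>v\<close> into \<open>y\<close>.\<close>

lemma full_component_9_pair:
  assumes v: "v \<in> V" "card (nb v) = 9" and full: "full_component v C"
    and yz: "y \<in> nb v" "z \<in> nb v" "y \<noteq> z" "dg (nb v) z < 8"
  shows "ar (nb v) + 32 \<le> 58 + 2 * dg (nb v) y + 2 * dg (nb v) z + (if (y, z) \<in> E then 0 else 2)"
proof -
  note sep = component_sep[OF v(1) full_componentD(1)[OF full] HOL.refl]
  define S where "S = E `` C \<inter> nb v"
  have fz: "z \<in> E `` C" "card S + dg (nb v) z = card (nb z \<inter> S) + 9"
    using full_component_nonnb[OF full, of z] yz v(2) by (simp_all add: S_def)
  obtain c where c: "c \<in> C" using conn_nonempty[OF sep(2)] by blast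
  have cA: "c \<notin> cnb v" using c sep(3) by blast
  have A: "cnb v \<subseteq> V" "cnb v \<inter> C = {}" "E `` C \<inter> cnb v = S"
    using cnb_subset[OF v(1)] sep(3,5) by (auto simp: S_def)
  define F1 where "F1 = attach E (cnb v) c (E `` C)"
  note F1 = minor_attach_C[OF A(1) sep(1,2) A(2) c, folded F1_def]
  have zc: "(z, c) \<in> F1" using fz(1) yz by (auto simp: F1_def attach_def)
  define F2 where "F2 = contr F1 z c"
  have W2: "insert c (cnb v) - {c} = cnb v" using cA by blast
  have "sgraph (insert c (cnb v) - {c}) F2" unfolding F2_def by (rule sgraph_contr[OF F1(2) zc])
  then have sF2: "sgraph (cnb v) F2" by (simp only: W2)
  have "minor (insert c (cnb v)) F1 (insert c (cnb v) - {c}) F2"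
    unfolding F2_def by (rule minor_contr[OF F1(2) zc])
  then have "minor (insert c (cnb v)) F1 (cnb v) F2" by (simp only: W2)
  then have mF2: "minor V E (cnb v) F2"
    using minor_trans[OF F1(1)] sF2 by (simp add: sgraph_def)
  have "F1 `` {z} \<inter> F1 `` {c} = nb z \<inter> S"
    using yz cA A(3) by (auto simp: F1_def attach_def)
  then have cF2: "card F2 + 2 + 2 * card (nb z \<inter> S) = card F1"
    using card_contr[OF F1(2) zc] by (simp add: F2_def)
  have yv: "(y, v) \<in> F2"
    using yz cA E_sym by (auto simp: F2_def contr_def F1_def attach_def)
  define F3 where "F3 = contr F2 y v"
  have W3: "cnb v - {v} = nb v" by auto
  have sF3: "sgraph (nb v) F3" using sgraph_contr[OF sF2 yv] by (simp only: W3 F3_def)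
  have "minor (cnb v) F2 (nb v) F3" using minor_contr[OF sF2 yv] by (simp only: W3 F3_def)
  then have mF3: "minor V E (nb v) F3" using minor_trans[OF mF2] sF3 by (simp add: sgraph_def)
  \<comment> \<open>After \<open>C\<close> is absorbed, \<open>z\<close> is a neighbour of
    \<open>y\<close> even if \<open>yz\<close> is not an edge of the graph. This possible extra
    common neighbour causes the correction by 2 in the statement.\<close>
  have "F2 `` {y} \<inter> F2 `` {v} \<subseteq> (nb y \<inter> nb v) \<union> (if (y, z) \<in> E then {} else {z})"
  proof
    fix w assume "w \<in> F2 `` {y} \<inter> F2 `` {v}"
    then have w: "(y, w) \<in> F2" "(v, w) \<in> F2" by auto
    have "w \<noteq> v" "w \<noteq> c" using w(2) by (auto simp: F2_def contr_def)
    have "w \<in> cnb v" using w(1) sF2 by (auto simp: sgraph_def)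
    have "(y, w) \<in> F1 \<or> w = z" using w(1) yz(3) by (auto simp: F2_def contr_def)
    then show "w \<in> (nb y \<inter> nb v) \<union> (if (y, z) \<in> E then {} else {z})"
      using \<open>w \<noteq> v\<close> \<open>w \<noteq> c\<close> \<open>w \<in> cnb v\<close> yz cA by (auto simp: F1_def attach_def)
  qed
  then have "card (F2 `` {y} \<inter> F2 `` {v}) \<le> card ((nb y \<inter> nb v) \<union> (if (y, z) \<in> E then {} else {z}))"
    by (intro card_mono) auto
  also have "\<dots> \<le> dg (nb v) y + (if (y, z) \<in> E then 0 else 1)"
    using card_Un_le[of "nb y \<inter> nb v" "if (y, z) \<in> E then {} else {z}"] by (simp split: if_splits)
  finally have "card (F2 `` {y} \<inter> F2 `` {v}) \<le> dg (nb v) y + (if (y, z) \<in> E then 0 else 1)" .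
  moreover have "card F3 + 2 + 2 * card (F2 `` {y} \<inter> F2 `` {v}) = card F2"
    using card_contr[OF sF2 yv] by (simp add: F3_def)
  moreover have "card F3 \<le> 58" using minor9_le[OF mF3 sF3 v(2)] .
  moreover have "card F1 = ar (nb v) + 18 + 2 * card S"
    using F1(3) A(3) ar_cnb[of v] v(2) by simp
  ultimately show ?thesis using cF2 fz(2) by (auto split: if_splits)
qed

text \<open>The minor contracts \<open>C\<close> to a single vertex, \<open>b\<close> into \<open>a\<close>, and \<open>v\<close> into \<open>y\<close>.\<close>

lemma full_component_9_edge:
  assumes v: "v \<in> V" "card (nb v) = 9" and fullC: "full_component v C" and full: "nb v \<subseteq> E `` C"
    and arH: "ar (nb v) = 46"
    and ab: "a \<in> nb v" "b \<in> nb v" "(a, b) \<in> E" and y: "y \<in> nb v" "y \<noteq> a" "y \<noteq> b"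
  shows "8 + (if (y, a) \<in> E \<and> (y, b) \<in> E then 1 else 0) \<le> card (nb a \<inter> nb b \<inter> nb v) + dg (nb v) y"
proof -
  note sep = component_sep[OF v(1) full_componentD(1)[OF fullC] HOL.refl]
  obtain c where c: "c \<in> C" using conn_nonempty[OF sep(2)] by blast
  have cA: "c \<notin> cnb v" "c \<noteq> v" using c sep(3) by blast+
  have A: "cnb v \<subseteq> V" "cnb v \<inter> C = {}" "E `` C \<inter> cnb v = nb v"
    using cnb_subset[OF v(1)] sep(3,5) full by auto
  define F1 where "F1 = attach E (cnb v) c (E `` C)"
  note F1 = minor_attach_C[OF A(1) sep(1,2) A(2) c, folded F1_def]
  have F1_iff: "(p, q) \<in> F1 \<longleftrightarrow> (p, q) \<in> E \<and> p \<in> cnb v \<and> q \<in> cnb v \<or> p = c \<and> q \<in> nb v \<or> q = c \<and> p \<in> nb v"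
    for p q unfolding F1_def attach_def A(3) by auto
  have abF: "(a, b) \<in> F1" using ab F1_iff by blast
  have "a \<noteq> b" using ab by auto
  define W2 where "W2 = insert c (cnb v) - {b}"
  define F2 where "F2 = contr F1 a b"
  have sF2: "sgraph W2 F2" unfolding F2_def W2_def by (rule sgraph_contr[OF F1(2) abF])
  have "minor (insert c (cnb v)) F1 W2 F2"
    unfolding F2_def W2_def by (rule minor_contr[OF F1(2) abF])
  then have mF2: "minor V E W2 F2" using minor_trans[OF F1(1)] sF2 by (simp add: sgraph_def)
  have "F1 `` {a} \<inter> F1 `` {b} \<subseteq> {v, c} \<union> (nb a \<inter> nb b \<inter> nb v)"
  proof
    fix w assume "w \<in> F1 `` {a} \<inter> F1 `` {b}"
    then have "(a, w) \<in> F1" "(b, w) \<in> F1" by auto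
    with ab cA show "w \<in> {v, c} \<union> (nb a \<inter> nb b \<inter> nb v)" unfolding F1_iff by auto
  qed
  then have "card (F1 `` {a} \<inter> F1 `` {b}) \<le> card ({v, c} \<union> (nb a \<inter> nb b \<inter> nb v))"
    by (intro card_mono) auto
  also have "\<dots> \<le> 2 + card (nb a \<inter> nb b \<inter> nb v)"
    using card_Un_le[of "{v, c}" "nb a \<inter> nb b \<inter> nb v"] cA by simp
  finally have c2: "card (F1 `` {a} \<inter> F1 `` {b}) \<le> 2 + card (nb a \<inter> nb b \<inter> nb v)" .
  have cF2: "card F2 + 2 + 2 * card (F1 `` {a} \<inter> F1 `` {b}) = card F1"
    using card_contr[OF F1(2) abF] by (simp add: F2_def)
  have "v \<noteq> b" "y \<noteq> v" using ab y by auto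
  have yv: "(y, v) \<in> F2"
    using y \<open>v \<noteq> b\<close> \<open>y \<noteq> v\<close> E_sym unfolding F2_def contr_def by (auto simp: F1_iff)
  define F3 where "F3 = contr F2 y v"
  have sF3: "sgraph (W2 - {v}) F3" using sgraph_contr[OF sF2 yv] by (simp only: F3_def)
  have "minor W2 F2 (W2 - {v}) F3" using minor_contr[OF sF2 yv] by (simp only: F3_def)
  then have mF3: "minor V E (W2 - {v}) F3" using minor_trans[OF mF2] sF3 by (simp add: sgraph_def)
  have "W2 - {v} = insert c (nb v - {b})" using cA ab by (auto simp: W2_def)
  then have "card (W2 - {v}) = 9" using cA ab(2) v(2) by simp
  with mF3 sF3 have "card F3 \<le> 58" by (intro minor9_le)
  moreover have "card F3 + 2 + 2 * card (F2 `` {y} \<inter> F2 `` {v}) = card F2"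
    using card_contr[OF sF2 yv] by (simp add: F3_def)
  \<comment> \<open>46 arcs in \<open>nb v\<close>, and 18 each for \<open>v\<close> and
    \<open>c\<close>, which both see all nine vertices.\<close>
  moreover have "card F1 = 82"
    using F1(3) A(3) ar_cnb[of v] v(2) arH by simp
  \<comment> \<open>If \<open>y\<close> sees both \<open>a\<close> and \<open>b\<close>, their
    merging removes one common neighbour of \<open>y\<close> and \<open>v\<close>; this saves one
    edge and yields the extra 1 in the conclusion.\<close>
  moreover have "card (F2 `` {y} \<inter> F2 `` {v}) + (if (y, a) \<in> E \<and> (y, b) \<in> E then 1 else 0) \<le> dg (nb v) y"
  proof -
    have sub: "F2 `` {y} \<inter> F2 `` {v} \<subseteq> (nb y \<inter> nb v - {b}) \<union> (if (y, b) \<in> E then {a} else {})"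
    proof
      fix w assume "w \<in> F2 `` {y} \<inter> F2 `` {v}"
      then have w: "(y, w) \<in> F2" "(v, w) \<in> F2" by auto
      have "w \<noteq> b" "(v, w) \<in> F1 \<or> w = a \<and> (v, b) \<in> F1" using w(2) ab(1) \<open>v \<noteq> b\<close> by (auto simp: F2_def contr_def)
      moreover have "(y, w) \<in> F1 \<or> w = a \<and> (y, b) \<in> F1" using w(1) y by (auto simp: F2_def contr_def)
      ultimately show "w \<in> (nb y \<inter> nb v - {b}) \<union> (if (y, b) \<in> E then {a} else {})"
        using y cA ab unfolding F1_iff by (auto split: if_splits)
    qed
    show ?thesis
    proof (cases "(y, b) \<in> E")
      case False
      then have "card (F2 `` {y} \<inter> F2 `` {v}) \<le> dg (nb v) y"
        using sub by (intro card_mono) auto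
      with False show ?thesis by simp
    next
      case yb: True
      have c1: "card (nb y \<inter> nb v - {b}) + 1 = dg (nb v) y"
      proof -
        have "b \<in> nb y \<inter> nb v" using yb ab(2) by auto
        then have "Suc (card (nb y \<inter> nb v - {b})) = dg (nb v) y"
          by (intro card_Suc_Diff1) auto
        then show ?thesis by simp
      qed
      show ?thesis
      proof (cases "(y, a) \<in> E")
        case True
        then have "F2 `` {y} \<inter> F2 `` {v} \<subseteq> nb y \<inter> nb v - {b}"
          using sub yb ab(1) \<open>a \<noteq> b\<close> by auto
        then have "card (F2 `` {y} \<inter> F2 `` {v}) \<le> card (nb y \<inter> nb v - {b})"
          by (intro card_mono) auto
        with c1 True yb show ?thesis by simp
      next
        case False
        have "card (F2 `` {y} \<inter> F2 `` {v}) \<le> card (insert a (nb y \<inter> nb v - {b}))"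
          using sub yb by (intro card_mono) auto
        also have "\<dots> \<le> card (nb y \<inter> nb v - {b}) + 1" by (simp add: card_insert_if)
        finally show ?thesis using c1 False by simp
      qed
    qed
  qed
  ultimately show ?thesis using cF2 c2 by (auto split: if_splits)
qed


text \<open>Here \<open>nb v\<close> alone has 9 vertices, so \<open>C\<close> and \<open>v\<close>
  must be contracted into it. The pair bound applied to vertices of small degree drives the arc
  number down to 46, which leaves \<open>nb v\<close> almost 5-regular; the edge bound then forces a
  K6 inside it and finally a vertex whose degree is too large.\<close>

lemma full_component_9:
  assumes v: "v \<in> V" "card (nb v) = 9" and full: "full_component v C"
  shows False
proof -
  let ?H = "nb v"
  define D5 where "D5 = {y \<in> ?H. dg ?H y = 5}"
  define D6 where "D6 = {y \<in> ?H. dg ?H y = 6}"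
  have D: "D5 \<subseteq> ?H" "D6 \<subseteq> ?H" "D5 \<inter> D6 = {}" by (auto simp: D5_def D6_def)
  then have fin: "finite D5" "finite D6" using finite_subset[OF _ finite_nb] by auto
  have HV: "?H \<subseteq> V" by (rule nb_subset)
  have pair: "ar ?H + 32 \<le> 58 + 2 * dg ?H y + 2 * dg ?H z + (if (y, z) \<in> E then 0 else 2)"
    if "y \<in> ?H" "z \<in> ?H" "y \<noteq> z" "dg ?H z < 8" for y z
    using full_component_9_pair[OF v full that] .
  have ev: "even (ar ?H)" by (rule ar_even[OF HV])
  have ub: "ar ?H \<le> 58" by (rule ar_bound9[OF HV v(2)])
  have cD: "card D5 \<le> 9" using card_mono[OF _ D(1)] v(2) by simp
  have sum1: "54 \<le> ar ?H + card D5"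
  proof -
    have "(\<Sum>y\<in>?H. 6) \<le> (\<Sum>y\<in>?H. dg ?H y + (if y \<in> D5 then 1 else 0))"
    proof (rule sum_mono)
      fix y assume y: "y \<in> ?H"
      then show "6 \<le> dg ?H y + (if y \<in> D5 then 1 else 0)"
        using dg_nb[OF y] by (cases "dg ?H y = 5") (auto simp: D5_def)
    qed
    also have "\<dots> = ar ?H + card D5"
      using D(1) fin by (simp add: sum.distrib ar_sum sum.If_cases Int_absorb1)
    finally show ?thesis using v(2) by simp
  qed
  have sum2: "63 \<le> ar ?H + 2 * card D5 + card D6"
  proof -
    have "(\<Sum>y\<in>?H. 7) \<le> (\<Sum>y\<in>?H. dg ?H y + ((if y \<in> D5 then 2 else 0) + (if y \<in> D6 then 1 else 0)))"
    proof (rule sum_mono)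
      fix y assume y: "y \<in> ?H"
      then show "7 \<le> dg ?H y + ((if y \<in> D5 then 2 else 0) + (if y \<in> D6 then 1 else 0))"
        using dg_nb[OF y] by (cases "dg ?H y = 5"; cases "dg ?H y = 6") (auto simp: D5_def D6_def)
    qed
    also have "\<dots> = ar ?H + (2 * card D5 + card D6)"
      using D fin by (simp add: sum.distrib ar_sum sum.If_cases Int_absorb1)
    finally show ?thesis using v(2) by simp
  qed
  \<comment> \<open>With fewer than two vertices of degree 5, \<open>nb v\<close> has at least 54
    arcs, but a pair of vertices of smallest degrees limits it to 52 or 50.\<close>
  have two: "2 \<le> card D5"
  proof (rule ccontr)
    assume "\<not> 2 \<le> card D5"
    then consider "card D5 = 0" | "card D5 = 1" by linarith
    then show False
    proof cases
      case 1
      then have "2 \<le> card D6" using sum2 ub by linarith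
      then obtain y z where "y \<in> D6" "z \<in> D6" "y \<noteq> z" by (rule card_two_distinct)
      then show False using pair[of y z] sum1 1 by (auto simp: D6_def split: if_splits)
    next
      case 2
      then have h: "1 \<le> card D6" "54 \<le> ar ?H" using sum1 sum2 ub ev by presburger+
      obtain y where y: "y \<in> D5" using 2 by fastforce
      obtain z where z: "z \<in> D6" using h(1) by fastforce
      have "y \<noteq> z" using y z D(3) by blast
      then show False using pair[of y z] y z h(2) by (auto simp: D5_def D6_def split: if_splits)
    qed
  qed
  \<comment> \<open>If \<open>D5\<close> were independent, the pair bound would give at most 48 arcs
    and hence at least 6 vertices in \<open>D5\<close>. Together with the 5 neighbours of one of
    them these exceed the 9 vertices available.\<close>
  have "\<exists>y\<in>D5. \<exists>z\<in>D5. (y, z) \<in> E"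
  proof (rule ccontr)
    assume neg: "\<not> ?thesis"
    obtain y z where yz: "y \<in> D5" "z \<in> D5" "y \<noteq> z" using two by (rule card_two_distinct)
    then have "ar ?H \<le> 48" using pair[of y z] by (auto simp: D5_def split: if_splits)
    moreover have "nb y \<inter> ?H \<inter> D5 = {}" using neg yz(1) by blast
    then have "card (nb y \<inter> ?H) + card D5 \<le> 9"
      using card_Int_ge[of ?H "nb y \<inter> ?H" D5] D(1) v(2) by simp
    ultimately show False using sum1 yz(1) by (simp add: D5_def)
  qed
  then obtain y z where yz: "y \<in> D5" "z \<in> D5" "(y, z) \<in> E" by blast
  moreover have "y \<noteq> z" using yz(3) by auto
  ultimately have "ar ?H \<le> 46" using pair[of y z] by (auto simp: D5_def)
  \<comment> \<open>The degree sum gives at least 54 - 9 = 45 arcs, and evenness excludes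
    45.\<close>
  then have arH: "ar ?H = 46" "8 \<le> card D5" using sum1 cD ev by presburger+
  have H5: "card (X - D5) \<le> 1" if "X \<subseteq> ?H" for X
  proof -
    have "card (X - D5) \<le> card (?H - D5)" using that by (intro card_mono) auto
    also have "\<dots> = 9 - card D5" using D(1) fin v(2) by (simp add: card_Diff_subset)
    finally show ?thesis using arH(2) by simp
  qed
  have inD5: "\<exists>x\<in>X. x \<in> D5" if "X \<subseteq> ?H" "2 \<le> card X" for X
  proof (rule ccontr)
    assume "\<not> ?thesis"
    then have "X - D5 = X" by blast
    then show False using H5[OF that(1)] that(2) by simp
  qed
  have dg6: "dg ?H y \<le> 6" if "y \<in> ?H" for y
  proof -
    have "ar ?H = dg ?H y + (\<Sum>z\<in>?H - {y}. dg ?H z)"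
      using that by (simp add: ar_sum sum.remove)
    moreover have "5 * card (?H - {y}) \<le> (\<Sum>z\<in>?H - {y}. dg ?H z)"
      using sum_bounded_below[of "?H - {y}" 5 "dg ?H"] dg_nb[of _ v] by (simp add: mult.commute)
    ultimately show ?thesis using arH(1) that v(2) by simp
  qed
  have fullH: "?H \<subseteq> E `` C"
  proof
    fix y assume y: "y \<in> ?H"
    show "y \<in> E `` C" by (rule full_component_nonnb(1)[OF full y]) (use dg6[OF y] v(2) in simp)
  qed
  have edge: "8 + (if (y, a) \<in> E \<and> (y, b) \<in> E then 1 else 0) \<le> card (nb a \<inter> nb b \<inter> ?H) + dg ?H y"
    if "a \<in> ?H" "b \<in> ?H" "(a, b) \<in> E" "y \<in> ?H" "y \<noteq> a" "y \<noteq> b" for a b y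
    by (rule full_component_9_edge[OF v full fullH arH(1) that])
  \<comment> \<open>The edge bound is used twice. Any outside vertex of degree 5 gives three common
    neighbours; one of these has degree 5 itself, and inserted as \<open>y\<close> it triggers the
    extra 1.\<close>
  have four: "4 \<le> card (nb a \<inter> nb b \<inter> ?H)" if ab: "a \<in> ?H" "b \<in> ?H" "(a, b) \<in> E" for a b
  proof (rule ccontr)
    assume not4: "\<not> ?thesis"
    have "a \<noteq> b" using ab(3) by auto
    then have "card (?H - {a, b}) = 7" using ab v(2) by (simp add: card_Diff_subset)
    then obtain y where "y \<in> ?H - {a, b}" "y \<in> D5" using inD5[of "?H - {a, b}"] by auto
    then have "3 \<le> card (nb a \<inter> nb b \<inter> ?H)" using edge[OF ab, of y] by (auto simp: D5_def split: if_splits)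
    then obtain y where y: "y \<in> nb a \<inter> nb b \<inter> ?H" "y \<in> D5" using inD5[of "nb a \<inter> nb b \<inter> ?H"] by auto
    then have "(y, a) \<in> E" "(y, b) \<in> E" "y \<noteq> a" "y \<noteq> b" by (auto intro: E_sym)
    then show False using edge[OF ab, of y] y not4 by (simp add: D5_def)
  qed
  \<comment> \<open>The five neighbours of \<open>p\<close> form a clique, since each shares four
    neighbours with \<open>p\<close>. A vertex \<open>w\<close> outside this K6 then has neighbours
    in the clique, and one of them of degree 5 would have 6 neighbours.\<close>
  obtain p where p: "p \<in> D5" using two by fastforce
  define T where "T = nb p \<inter> ?H"
  have T: "card T = 5" "T \<subseteq> ?H" "p \<notin> T" "finite T" using p by (auto simp: T_def D5_def)
  have pH: "p \<in> ?H" using p D by blast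
  have Tclique: "(a, b) \<in> E" if "a \<in> T" "b \<in> T" "a \<noteq> b" for a b
  proof -
    have "(p, a) \<in> E" "a \<in> ?H" using that(1) by (auto simp: T_def)
    then have "4 \<le> card (nb p \<inter> nb a \<inter> ?H)" using four[OF pH] by blast
    also have "nb p \<inter> nb a \<inter> ?H = nb a \<inter> T" by (auto simp: T_def)
    finally have "card (T - {a}) \<le> card (nb a \<inter> T)" using that(1) T by simp
    moreover have "nb a \<inter> T \<subseteq> T - {a}" by auto
    ultimately have "nb a \<inter> T = T - {a}" using T(4) by (intro card_seteq) auto
    then show ?thesis using that by blast
  qed
  define O' where "O' = ?H - insert p T"
  have "card O' = 3"
    unfolding O'_def using T pH v(2) by (simp add: card_Diff_subset)
  then obtain w where w: "w \<in> O'" "w \<in> D5" using inD5[of O'] by (auto simp: O'_def)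
  define Q where "Q = nb w \<inter> ?H"
  have Q: "card Q = 5" "finite Q" using w by (auto simp: Q_def D5_def)
  have "p \<notin> Q" using w E_sym by (auto simp: Q_def O'_def T_def)
  \<comment> \<open>At most two of the five neighbours of \<open>w\<close> lie among the other
    vertices of \<open>O'\<close>, so at least three lie in \<open>T\<close>.\<close>
  then have "Q \<subseteq> (Q \<inter> T) \<union> (O' - {w})" by (auto simp: Q_def O'_def)
  then have "card Q \<le> card ((Q \<inter> T) \<union> (O' - {w}))"
    using Q T by (intro card_mono) (auto simp: O'_def)
  also have "\<dots> \<le> card (Q \<inter> T) + card (O' - {w})" by (rule card_Un_le)
  also have "card (O' - {w}) = 2" using w \<open>card O' = 3\<close> by simp
  finally have "2 \<le> card (Q \<inter> T)" using Q by simp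
  then obtain a where a: "a \<in> Q \<inter> T" "a \<in> D5" using inD5[of "Q \<inter> T"] T by blast
  have "insert p (insert w (T - {a})) \<subseteq> nb a \<inter> ?H"
  proof -
    have "(a, p) \<in> E" "(a, w) \<in> E" using a E_sym by (auto simp: Q_def T_def)
    moreover have "w \<in> ?H" using w by (simp add: O'_def)
    moreover have "T - {a} \<subseteq> nb a" using Tclique a by blast
    ultimately show ?thesis using pH T(2) by blast
  qed
  then have "card (insert p (insert w (T - {a}))) \<le> dg ?H a" by (intro card_mono) auto
  moreover have "card (insert p (insert w (T - {a}))) = 6"
    using a T w by (auto simp: O'_def)
  ultimately show False using a(2) by (simp add: D5_def)
qed

lemma no_full_component:
  assumes "v \<in> V" "7 \<le> card (nb v)" "card (nb v) \<le> 9" "full_component v C"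
  shows False
proof -
  consider "card (nb v) = 7" | "card (nb v) = 8" | "card (nb v) = 9" using assms(2,3) by linarith
  then show False
    using full_component_7 full_component_8 full_component_9 assms(1,4) by cases blast+
qed

text \<open>If all degrees in \<open>K\<close> were at least 10, then \<open>K\<close> with its
  attachment set \<open>S\<close> would be so dense that contracting \<open>x\<close> into the
  vertex of \<open>S\<close> with fewest neighbours in \<open>S\<close> violates minimality unless
  \<open>card S\<close> is 8 or 9. Those two cases are excluded directly.\<close>

lemma component_small_degree:
  assumes x: "x \<in> V" "card (nb x) \<le> 9" and K: "component E (V - cnb x) K"
  shows "\<exists>k\<in>K. card (nb k) \<le> 9"
proof (rule ccontr)
  assume "\<not> ?thesis"
  then have big: "10 \<le> card (nb k)" if "k \<in> K" for k using that by fastforce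
  define S where "S = E `` K \<inter> nb x"
  note sep = component_sep[OF x(1) K S_def]
  define A where "A = K \<union> S"
  have AV: "A \<subseteq> V" using sep(10) by (auto simp: A_def)
  have KS: "K \<inter> S = {}" "S \<subseteq> nb x" "finite K" "finite S" using sep(1,3) by (auto simp: S_def)
  obtain k where k: "k \<in> K" using conn_nonempty[OF sep(2)] by blast
  have nbK: "nb k \<subseteq> A" if "k \<in> K" for k using that sep(4) by (auto simp: A_def)
  have cA: "card A = card K + card S" using KS by (simp add: A_def card_Un_disjoint)
  have "card (nb k) \<le> card A" using nbK[OF k] AV by (intro card_mono) auto
  then have c9: "9 \<le> card A" using big[OF k] by linarith
  have ltA: "card A < card V" using sep(10) x(1) finite_V by (intro psubset_card_mono) (auto simp: A_def)
  \<comment> \<open>A neighbour \<open>c\<close> of \<open>y\<close> in \<open>K\<close> and the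
    common neighbours of \<open>c\<close> and \<open>y\<close> all lie in \<open>A\<close>, because
    neighbours of \<open>c\<close> do.\<close>
  have dS: "6 \<le> dg A y" if y: "y \<in> S" for y
  proof -
    obtain c where c: "c \<in> K" "(c, y) \<in> E" using y by (auto simp: S_def)
    have "insert c (nb c \<inter> nb y) \<subseteq> nb y \<inter> A" using c nbK[OF c(1)] E_sym by (auto simp: A_def)
    then have "card (insert c (nb c \<inter> nb y)) \<le> dg A y" by (intro card_mono) auto
    then show ?thesis using edge_triangles[OF c(2)] by simp
  qed
  have arA: "10 * card K + 6 * card S \<le> ar A"
  proof -
    have "ar A = (\<Sum>y\<in>K. dg A y) + (\<Sum>y\<in>S. dg A y)"
      using KS by (simp add: ar_sum A_def sum.union_disjoint)
    moreover have "10 * card K \<le> (\<Sum>y\<in>K. dg A y)"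
      using sum_bounded_below[of K 10 "dg A"] big nbK by (simp add: Int_absorb2 mult.commute)
    moreover have "6 * card S \<le> (\<Sum>y\<in>S. dg A y)"
      using sum_bounded_below[of S 6 "dg A"] dS by (simp add: mult.commute)
    ultimately show ?thesis by linarith
  qed
  show False
  proof (cases "S = {}")
    case True
    then show False using arA ar_bound[OF AV c9 ltA] cA by simp
  next
    case False
    define \<delta> where "\<delta> = Min (dg S ` S)"
    have "\<delta> \<in> dg S ` S" unfolding \<delta>_def using False KS by (intro Min_in) auto
    then obtain y where y: "y \<in> S" "dg S y = \<delta>" by auto
    have \<delta>: "\<delta> \<le> dg S z" if "z \<in> S" for z unfolding \<delta>_def using that KS by (intro Min_le) auto
    have eA: "E `` {x} \<inter> A = S" using sep(3) KS by (auto simp: A_def)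
    have "ar A + 2 * card (nb x \<inter> A) + 28 \<le> 10 * card A + 2 * card (nb y \<inter> (nb x \<inter> A))"
      using sep(10) x(1) y(1) eA by (intro absorb_bound AV c9) (auto simp: A_def)
    then have "28 \<le> 2 * card S + 2 * \<delta>" using arA cA y(2) unfolding eA by linarith
    moreover have "\<delta> \<le> card S - 1" using dg_le[OF KS(4) y(1)] y(2) by simp
    moreover have cS: "card S \<le> card (nb x)" using KS(2) by (intro card_mono) auto
    \<comment> \<open>The inequality reads \<open>card S + \<delta> \<ge> 14\<close>, with
      \<open>\<delta>\<close> below \<open>card S\<close> and \<open>card S\<close> at most
      9.\<close>
    ultimately consider "card S = 8" "6 \<le> \<delta>" | "card S = 9" using x(2) by linarith
    then show False
    proof cases
      case 1
      have "x \<notin> S" using KS by auto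
      have "6 * card S \<le> ar S" using \<delta> 1 by (intro ar_ge KS(4)) fastforce
      moreover have "ar (insert x S) = ar S + 2 * card S"
        using ar_insert[OF KS(4) \<open>x \<notin> S\<close>] KS(2) by (simp add: Int_absorb1)
      moreover have "ar (insert x S) \<le> 58"
        using 1 KS AV x(1) \<open>x \<notin> S\<close> by (intro ar_bound9) (auto simp: A_def)
      ultimately show False using 1 by simp
    next
      case 2
      then have "S = nb x" using KS(2) cS x(2) by (intro card_seteq) auto
      then have "full_component x K" using K S_def by (auto simp: full_component_def)
      moreover have "card (nb x) = 9" using 2 cS x(2) by linarith
      ultimately show False using full_component_9[OF x(1)] by blast
    qed
  qed
qed


subsection \<open>Vertices of degree 6\<close>

text \<open>Five triangles on the edge from \<open>v\<close> to \<open>y\<close> account for all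
  five other vertices of \<open>nb v\<close>.\<close>

lemma nb6_clique:
  assumes "card (nb v) = 6" "y \<in> nb v" "z \<in> nb v" "y \<noteq> z"
  shows "(y, z) \<in> E"
proof -
  have "nb y \<inter> nb v \<subseteq> nb v - {y}" by auto
  moreover have "card (nb v - {y}) \<le> dg (nb v) y" using dg_nb[OF assms(2)] assms(1,2) by simp
  ultimately have "nb y \<inter> nb v = nb v - {y}" by (intro card_seteq) auto
  with assms show ?thesis by blast
qed

lemma cnb6_clique:
  assumes "card (nb v) = 6" "y \<in> cnb v" "z \<in> cnb v" "y \<noteq> z"
  shows "(y, z) \<in> E"
  using assms nb6_clique E_sym by blast

lemma ar_cnb6:
  assumes "card (nb v) = 6"
  shows "ar (cnb v) = 42"
proof -
  have "ar (cnb v) = card (cnb v) * (card (cnb v) - 1)"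
    by (rule ar_clique) (simp, rule cnb6_clique[OF assms])
  then show ?thesis using assms by simp
qed

text \<open>Two copies of K7 sharing five vertices have 9 vertices and 42 + 42 - 20 = 64 arcs. If
  they share four, the two vertices of \<open>nb v\<close> outside the overlap are contracted
  together, which gives 60 arcs on 9 vertices.\<close>

lemma common_nbs_degree6:
  assumes x: "x \<in> V" "card (nb x) = 6" and v: "v \<in> V" "card (nb v) = 6"
    and xv: "x \<noteq> v" "(x, v) \<notin> E"
  shows "card (nb x \<inter> nb v) \<noteq> 4" "card (nb x \<inter> nb v) \<noteq> 5"
proof -
  define J where "J = nb x \<inter> nb v"
  have vx: "(v, x) \<notin> E" using xv(2) E_sym by blast
  have J: "cnb x \<inter> cnb v = J" using xv vx by (auto simp: J_def)
  show "card (nb x \<inter> nb v) \<noteq> 5"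
  proof
    assume "card (nb x \<inter> nb v) = 5"
    then have J5: "card J = 5" by (simp add: J_def)
    have "card (cnb x) + card (cnb v) = card (cnb x \<union> cnb v) + card J"
      using J card_Un_Int[of "cnb x" "cnb v"] by simp
    then have "card (cnb x \<union> cnb v) = 9" using J5 x v by simp
    then have "ar (cnb x \<union> cnb v) \<le> 58"
      using cnb_subset[OF x(1)] cnb_subset[OF v(1)] by (intro ar_bound9) auto
    moreover have "ar (cnb x) + ar (cnb v) \<le> ar (cnb x \<union> cnb v) + ar J"
    proof -
      let ?R = "\<lambda>A. E \<inter> A \<times> A"
      have "card (?R (cnb x)) + card (?R (cnb v))
          = card (?R (cnb x) \<union> ?R (cnb v)) + card (?R (cnb x) \<inter> ?R (cnb v))"
        using finite_E by (intro card_Un_Int) auto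
      also have "?R (cnb x) \<inter> ?R (cnb v) = ?R J" using J by blast
      also have "card (?R (cnb x) \<union> ?R (cnb v)) \<le> card (?R (cnb x \<union> cnb v))"
        using finite_E by (intro card_mono) auto
      finally show ?thesis by (simp add: ar_def)
    qed
    moreover have "ar J \<le> 20" using ar_le[of J] J5 by (simp add: J_def)
    ultimately show False using ar_cnb6 x v by fastforce
  qed
  show "card (nb x \<inter> nb v) \<noteq> 4"
  proof
    assume "card (nb x \<inter> nb v) = 4"
    then have J4: "card J = 4" by (simp add: J_def)
    have "card (nb v - J) = 2" using J4 v(2) by (subst card_Diff_subset) (auto simp: J_def)
    then obtain p q where pq: "nb v - J = {p, q}" "p \<noteq> q" by (auto simp: card_2_iff)
    then have pq': "p \<in> nb v" "q \<in> nb v" "p \<notin> cnb x" "q \<notin> cnb x"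
      using vx by (auto simp: J_def)
    \<comment> \<open>\<open>A\<close> has 42 + 8 arcs, and the contracted edge \<open>pq\<close>
      sees \<open>v\<close> and the four common neighbours, adding 10.\<close>
    define A where "A = insert v (cnb x)"
    have vA: "v \<notin> cnb x" using xv by auto
    have "card A = 8" using vA x(2) by (simp add: A_def)
    moreover have "A \<subseteq> V" using cnb_subset[OF x(1)] v(1) by (simp add: A_def)
    moreover have "A \<inter> {p, q} = {}" using pq' by (auto simp: A_def)
    moreover have "conn E {p, q}" using nb6_clique[OF v(2)] pq'
      by (intro conn_clique) auto
    moreover have "{p, q} \<subseteq> V" using pq' nb_subset by blast
    ultimately have "ar A + 2 * card (E `` {p, q} \<inter> A) \<le> 58" by (intro attach_bound)
    moreover have "card (insert v J) \<le> card (E `` {p, q} \<inter> A)"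
    proof (rule card_mono)
      have "(p, j) \<in> E" if "j \<in> J" for j
        using nb6_clique[OF v(2) pq'(1)] that pq by (auto simp: J_def)
      moreover have "(p, v) \<in> E" using pq'(1) E_sym by blast
      ultimately show "insert v J \<subseteq> E `` {p, q} \<inter> A" by (auto simp: A_def J_def)
    qed (simp add: A_def)
    moreover have "card (insert v J) = 5" using J4 by (simp add: J_def)
    moreover have "nb v \<inter> cnb x = J" using vx by (auto simp: J_def)
    then have "ar A = 42 + 2 * card J"
      unfolding A_def using ar_insert[OF _ vA] ar_cnb6[OF x(2)] by simp
    ultimately show False using J4 by simp
  qed
qed

text \<open>Since \<open>S\<close> is a clique, the count across the separation contains s(s - 1)
  arcs for its middle, where s is \<open>card S\<close>. This leaves only separations in which one
  side is a K7; the alternatives are the two possible sides.\<close>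

lemma degree6_component_cases:
  assumes v: "v \<in> V" "card (nb v) = 6" and C: "component E (V - cnb v) C"
  shows "C = V - cnb v \<and> 5 \<le> card (E `` C \<inter> nb v) \<or> (\<exists>c. C = {c} \<and> nb v = nb c)"
proof -
  define S where "S = E `` C \<inter> nb v"
  note sep = component_sep[OF v(1) C S_def]
  have C0: "C \<noteq> {}" using sep(2) by (rule conn_nonempty)
  have SH: "S \<subseteq> nb v" "finite S" by (auto simp: S_def)
  have s6: "card S \<le> 6" using card_mono[OF _ SH(1)] v(2) by simp
  have arS: "ar S = card S * (card S - 1)"
    using SH nb6_clique[OF v(2)] by (intro ar_clique) auto
  have lt: "card (C \<union> S) < card V" "card (V - C) < card V"
    using sep(1,10) v(1) C0 by (auto intro!: psubset_card_mono finite_V)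
  have AV: "C \<union> S \<subseteq> V" using sep(10) by blast
  have b7: "7 \<le> card (V - C)" using card_mono[OF _ sep(9)] v(2) finite_V by simp
  \<comment> \<open>A side with 8 vertices becomes a 9-vertex minor by adding one vertex from the
    other side: \<open>v\<close> itself here, the contracted \<open>C\<close> in
    \<open>B8\<close>.\<close>
  have A8: "ar (C \<union> S) + 2 * card S \<le> 58" if "card (C \<union> S) = 8"
  proof -
    have "v \<notin> C \<union> S" using sep(10) by blast
    moreover have "nb v \<inter> (C \<union> S) = S" using sep(3) SH by auto
    ultimately have "ar (insert v (C \<union> S)) = ar (C \<union> S) + 2 * card S"
      using ar_insert[of "C \<union> S" v] AV by (metis finite_sub)
    moreover have "ar (insert v (C \<union> S)) \<le> 58"
      using \<open>v \<notin> C \<union> S\<close> that AV v(1) by (intro ar_bound9) auto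
    ultimately show ?thesis by simp
  qed
  have B8: "ar (V - C) + 2 * card S \<le> 58" if "card (V - C) = 8"
  proof -
    have "E `` C \<inter> (V - C) = S" using sep(3,4) SH nb_subset[of "{v}"] by (auto simp: S_def)
    moreover have "(V - C) \<inter> C = {}" by blast
    ultimately show ?thesis using attach_bound[OF Diff_subset sep(1,2) _ that] by simp
  qed
  have cases7: "ar X \<le> 42 \<and> card X = 7 \<or> ar X + 2 * card S \<le> 58 \<and> ar X \<le> 56 \<and> card X = 8 \<or>
      ar X + 30 \<le> 10 * card X \<and> 9 \<le> card X"
    if h: "X \<subseteq> V" "7 \<le> card X" "card X < card V" "card X = 8 \<Longrightarrow> ar X + 2 * card S \<le> 58" for X
  proof -
    consider "card X = 7" | "card X = 8" | "9 \<le> card X" using h(2) by linarith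
    then show ?thesis
      using ar_le[OF finite_sub[OF h(1)]] ar_bound[OF h(1)] h(3,4) by cases auto
  qed
  have cA: "ar (C \<union> S) \<le> 42 \<and> card (C \<union> S) = 7 \<or>
      ar (C \<union> S) + 2 * card S \<le> 58 \<and> ar (C \<union> S) \<le> 56 \<and> card (C \<union> S) = 8 \<or>
      ar (C \<union> S) + 30 \<le> 10 * card (C \<union> S) \<and> 9 \<le> card (C \<union> S)"
    using cases7[OF AV sep(8) lt(1) A8] .
  have cB: "ar (V - C) \<le> 42 \<and> card (V - C) = 7 \<or>
      ar (V - C) + 2 * card S \<le> 58 \<and> ar (V - C) \<le> 56 \<and> card (V - C) = 8 \<or>
      ar (V - C) + 30 \<le> 10 * card (V - C) \<and> 9 \<le> card (V - C)"
    using cases7[OF Diff_subset b7 lt(2) B8] .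
  \<comment> \<open>Two sides with at least 9 vertices would need s^2 - 11s + 32 <= 0, which never
    holds. Fixing s makes the remaining small cases linear.\<close>
  have main: "card (V - C) = 7 \<and> 5 \<le> card S \<or> card (C \<union> S) = 7 \<and> 4 \<le> card S"
  proof -
    consider "card S = 0" | "card S = 1" | "card S = 2" | "card S = 3" | "card S = 4" | "card S = 5" | "card S = 6"
      using s6 by linarith
    then show ?thesis
      using cA cB sep(6,7) arS card_E card_V by cases (simp_all, linarith+)
  qed
  show ?thesis
  proof (cases "card (V - C) = 7 \<and> 5 \<le> card S")
    case True
    then have "cnb v = V - C" using sep(9) v(2) finite_V by (intro card_subset_eq) auto
    then show ?thesis using True sep(1) by (auto simp: S_def)
  next
    case False
    with main have A7: "card (C \<union> S) = 7" "4 \<le> card S" by auto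
    obtain c where c: "c \<in> C" using C0 by blast
    have cv: "c \<in> V" "c \<noteq> v" "(v, c) \<notin> E" using c sep(1,3) by auto
    \<comment> \<open>A vertex of \<open>C\<close> has a closed neighbourhood of at least 7 vertices
      inside this 7-element set, so it also has degree 6 and the counts of common neighbours
      apply.\<close>
    have cc: "cnb c = C \<union> S"
      using c sep(4) min_degree[OF cv(1)] A7 AV by (intro card_seteq) auto
    have "card (cnb c) = 7" unfolding cc by (rule A7(1))
    then have c6: "card (nb c) = 6" by simp
    have "c \<notin> S" using cv(3) SH by auto
    have nbc: "nb c = C \<union> S - {c}" using cc by auto
    have "nb v \<inter> nb c = S" using nbc sep(3) SH \<open>c \<notin> S\<close> by auto
    then have "card S \<noteq> 4" "card S \<noteq> 5"
      using common_nbs_degree6[OF v cv(1) c6] cv(2,3) by auto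
    then have S6: "card S = 6" using A7(2) s6 by linarith
    have "card C + card S = 7"
      using A7(1) sep(3) SH sep(1) by (subst (asm) card_Un_disjoint) auto
    then have "card C = 1" using S6 by simp
    then have "C = {c}" using c by (auto simp: card_1_singleton_iff)
    moreover have "S = nb v" using SH S6 v(2) by (intro card_subset_eq) auto
    ultimately show ?thesis using nbc \<open>c \<notin> S\<close> by auto
  qed
qed

text \<open>A component that is a twin \<open>c\<close> of \<open>v\<close> leaves further vertices
  because there are at least 10, and their component must be a twin too. A K6 joined to three
  independent vertices is already too dense.\<close>

lemma degree6_complement:
  assumes v: "v \<in> V" "card (nb v) = 6"
  shows "conn E (V - cnb v)" "5 \<le> card (E `` (V - cnb v) \<inter> nb v)"
proof -
  have nonempty: "V - cnb v - {c} \<noteq> {}" for c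
  proof
    assume "V - cnb v - {c} = {}"
    then have "V \<subseteq> insert c (cnb v)" by blast
    then have "card V \<le> card (insert c (cnb v))" by (intro card_mono) auto
    also have "\<dots> \<le> 8" using v(2) by (simp add: card_insert_if)
    finally show False using card_V by simp
  qed
  obtain x where "x \<in> V - cnb v" using nonempty[of v] by blast
  then obtain C where C: "component E (V - cnb v) C" by (meson component_exists sym_E)
  have "C = V - cnb v \<and> 5 \<le> card (E `` C \<inter> nb v)"
  proof (rule ccontr)
    assume neg: "\<not> ?thesis"
    then obtain c where c: "C = {c}" "nb v = nb c" using degree6_component_cases[OF v C] by blast
    obtain x' where x': "x' \<in> V - cnb v" "x' \<noteq> c" using nonempty[of c] by blast
    then obtain C' where C': "component E (V - cnb v) C'" "x' \<in> C'" by (meson component_exists sym_E)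
    have cc: "c \<in> V" "c \<notin> cnb v" using C c by (auto simp: component_def)
    have "c \<notin> C'"
    proof
      assume "c \<in> C'"
      then have "C' \<subseteq> C" using C C' c by (intro component_absorbs[OF C]) (auto simp: component_def)
      with C'(2) x'(2) c show False by blast
    qed
    then have "C' \<noteq> V - cnb v" using cc by blast
    then obtain c' where c': "C' = {c'}" "nb v = nb c'" using degree6_component_cases[OF v C'(1)] by blast
    have c'V: "c' \<in> V" "c' \<notin> cnb v" "c' \<noteq> c" using C' c' x' by (auto simp: component_def)
    have "nb c \<inter> cnb v = nb v" using c(2) by auto
    then have 1: "ar (insert c (cnb v)) = 54"
      using ar_insert[of "cnb v" c] cc(2) ar_cnb6[OF v(2)] v(2) by simp
    have "c \<notin> nb c'" using c'(2) cc by simp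
    then have "nb c' \<inter> insert c (cnb v) = nb v" using c'(2) by auto
    \<comment> \<open>42 arcs of \<open>cnb v\<close> plus 12 for each of the two twins.\<close>
    then have "ar (insert c' (insert c (cnb v))) = 66"
      using ar_insert[of "insert c (cnb v)" c'] c'V 1 v(2) by simp
    moreover have "ar (insert c' (insert c (cnb v))) \<le> 58"
      using cc c'V cnb_subset[OF v(1)] v(2) by (intro ar_bound9) auto
    ultimately show False by simp
  qed
  with C show "conn E (V - cnb v)" "5 \<le> card (E `` (V - cnb v) \<inter> nb v)"
    by (auto simp: component_def)
qed


text \<open>Contracting four linking paths makes four common vertices of two copies of \<open>K\<^sub>7\<close>; one edge among
  the three further vertices of the second copy is contracted to leave \<open>9\<close> vertices.\<close>

lemma no_linkage:
  assumes x: "card (nb x) = 6" "x \<in> V" and v: "card (nb v) = 6" "v \<in> V"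
    and \<P>: "linkage V E (cnb x) (cnb v) \<P>" "card \<P> = 4"
    and meet: "cnb x \<inter> cnb v \<subseteq> \<Union>\<P>"
  shows False
proof -
  define T where "T = cnb x"
  define Z where "Z = cnb v"
  define U0 where "U0 = T \<inter> \<Union>\<P>"
  have cT: "card T = 7" "finite T" "T \<subseteq> V" using x cnb_subset by (auto simp: T_def)
  have cZ: "card Z = 7" "finite Z" "Z \<subseteq> V" using v cnb_subset by (auto simp: Z_def)
  have Tcl: "(a, b) \<in> E" if "a \<in> T" "b \<in> T" "a \<noteq> b" for a b
    using cnb6_clique[OF x(1)] that unfolding T_def by blast
  have Zcl: "(a, b) \<in> E" if "a \<in> Z" "b \<in> Z" "a \<noteq> b" for a b
    using cnb6_clique[OF v(1)] that unfolding Z_def by blast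
  have link: "linkage V E T Z \<P>" using \<P>(1) by (simp add: T_def Z_def)
  have cU0: "card U0 = 4" unfolding U0_def using linkage_card_ends[OF link] \<P>(2) by simp
  have "card (Z - \<Union>\<P>) = 3"
  proof -
    have "card (Z - Z \<inter> \<Union>\<P>) = card Z - card (Z \<inter> \<Union>\<P>)"
      using cZ by (intro card_Diff_subset) auto
    then show ?thesis
      using linkage_card_ends[OF linkage_swap[OF link]] \<P>(2) cZ by (simp add: Diff_Int_distrib2 Diff_Int)
  qed
  then obtain r1 r2 r3 where r: "Z - \<Union>\<P> = {r1, r2, r3}" "r1 \<noteq> r2" "r1 \<noteq> r3" "r2 \<noteq> r3"
    by (auto simp: card_3_iff)
  have rZ: "r1 \<in> Z" "r2 \<in> Z" "r3 \<in> Z" and rP: "r1 \<notin> \<Union>\<P>" "r2 \<notin> \<Union>\<P>" "r3 \<notin> \<Union>\<P>"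
    using r(1) by blast+
  \<comment> \<open>\<open>meet\<close> enters here: a vertex common to both cliques lies on a path,
    so the three leftover vertices are really new.\<close>
  have rT: "r1 \<notin> T" "r2 \<notin> T" "r3 \<notin> T" using rZ rP meet[folded T_def Z_def] by blast+
  define q where "q w = (if w \<in> \<Union>\<P> then SOME P. P \<in> \<P> \<and> w \<in> P else {w})" for w
  have q1: "q w \<in> \<P>" "w \<in> q w" if "w \<in> \<Union>\<P>" for w
  proof -
    have "\<exists>P. P \<in> \<P> \<and> w \<in> P" using that by blast
    from someI_ex[OF this] that show "q w \<in> \<P>" "w \<in> q w" by (simp_all add: q_def)
  qed
  have q2: "q w = {w}" if "w \<notin> \<Union>\<P>" for w using that by (simp add: q_def)
  have qself: "w \<in> q w" for w using q1 q2 by (cases "w \<in> \<Union>\<P>") auto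
  have qT: "q w \<inter> T = {w}" if "w \<in> T" for w
  proof (cases "w \<in> \<Union>\<P>")
    case True
    then obtain a where a: "q w \<inter> T = {a}" using linkageD(3)[OF link q1(1)] by blast
    moreover have "w \<in> q w \<inter> T" using that qself by blast
    ultimately have "w = a" by simp
    then show ?thesis using a by simp
  next
    case False
    with that q2 show ?thesis by simp
  qed
  have qnot: "w \<notin> q w'" if "w \<in> T" "w' \<in> T" "w \<noteq> w'" for w w'
  proof
    assume "w \<in> q w'"
    with that(1) have "w \<in> q w' \<inter> T" by simp
    with qT[OF that(2)] that(3) show False by simp
  qed
  have qdisj: "q w \<inter> q w' = {}" if w: "w \<in> T" "w' \<in> T" "w \<noteq> w'" for w w'
  proof -
    have ne: "q w \<noteq> q w'" using qT[OF w(1)] qT[OF w(2)] w(3) by auto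
    show ?thesis
    proof (cases "w \<in> \<Union>\<P> \<and> w' \<in> \<Union>\<P>")
      case True
      then show ?thesis using linkageD(5)[OF link q1(1) q1(1) ne] by blast
    next
      case False
      then consider "w \<notin> \<Union>\<P>" | "w' \<notin> \<Union>\<P>" by blast
      then show ?thesis
      proof cases
        case 1
        then have "q w = {w}" by (rule q2)
        then show ?thesis using qnot[OF w] by simp
      next
        case 2
        then have "q w' = {w'}" by (rule q2)
        then show ?thesis using qnot[OF w(2,1)] w(3) by simp
      qed
    qed
  qed
  have qr: "ri \<notin> q w" if "w \<in> T" "ri \<in> {r1, r2, r3}" for w ri
  proof (cases "w \<in> \<Union>\<P>")
    case True
    then show ?thesis using q1(1) rP that(2) by blast
  next
    case False
    then show ?thesis using q2 rT that by auto
  qed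
  define U where "U = insert r1 (insert r2 U0)"
  define W where "W = insert r1 (insert r2 T)"
  define F where "F = (T \<times> T \<union> U \<times> U) - Id"
  \<comment> \<open>Vertices of \<open>T\<close> carry their paths, or themselves if on no path.
    Merging \<open>r2\<close> with \<open>r3\<close> brings the 10 available vertices down to
    9.\<close>
  define B where "B w = (if w = r1 then {r1} else if w = r2 then {r2, r3} else q w)" for w
  have BT: "B w = q w" if "w \<in> T" for w using that rT by (auto simp: B_def)
  have Br: "B r1 = {r1}" "B r2 = {r2, r3}" using r(2) by (auto simp: B_def)
  have UW: "U \<subseteq> W" "T \<subseteq> W" "finite W" "finite U" using cT by (auto simp: U_def W_def U0_def)
  have cU: "card U = 6" using cU0 rT r(2) cT by (simp add: U_def U0_def)
  have cW: "card W = 9" using rT r(2) cT by (simp add: W_def)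
  have mF: "minor V E W F"
  proof (rule minorI[of W B])
    fix w assume w: "w \<in> W"
    show "B w \<subseteq> V"
    proof (cases "w \<in> T")
      case True
      then show ?thesis using BT cT(3) linkageD(1)[OF link q1(1)] q2 by (cases "w \<in> \<Union>\<P>") auto
    next
      case False
      then show ?thesis using w Br rZ cZ(3) by (auto simp: W_def)
    qed
    show "conn E (B w)"
    proof (cases "w \<in> T")
      case True
      then show ?thesis using BT linkageD(2)[OF link q1(1)] q2 by (cases "w \<in> \<Union>\<P>") auto
    next
      case False
      moreover have "conn E {r2, r3}" using Zcl rZ by (intro conn_clique) auto
      ultimately show ?thesis using w Br by (auto simp: W_def)
    qed
  next
    have disj: "B w \<inter> B w' = {}" if "w \<in> T" "w' \<in> W" "w \<noteq> w'" for w w'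
    proof (cases "w' \<in> T")
      case True
      then show ?thesis using BT qdisj that by simp
    next
      case False
      then have "w' = r1 \<or> w' = r2" using that by (auto simp: W_def)
      then show ?thesis using BT[OF that(1)] Br qr[OF that(1)] by auto
    qed
    fix w w' assume w: "w \<in> W" "w' \<in> W" "w \<noteq> w'"
    show BB: "B w \<inter> B w' = {}"
    proof (cases "w \<in> T \<or> w' \<in> T")
      case True
      then show ?thesis using disj[of w w'] disj[of w' w] w by blast
    next
      case False
      then show ?thesis using w Br r by (auto simp: W_def)
    qed
  next
    fix w w' assume "(w, w') \<in> F"
    then have ww: "w \<noteq> w'" "w \<in> T \<and> w' \<in> T \<or> w \<in> U \<and> w' \<in> U" by (auto simp: F_def)
    have U_end: "\<exists>z. z \<in> B u \<and> z \<in> Z" if "u \<in> U" for u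
    proof (cases "u \<in> U0")
      case True
      then have "u \<in> \<Union>\<P>" "u \<in> T" by (auto simp: U0_def)
      then have "\<exists>b. q u \<inter> Z = {b}" using linkageD(4)[OF link q1(1)] by blast
      then show ?thesis using BT[OF \<open>u \<in> T\<close>] by blast
    next
      case False
      then show ?thesis using that Br rZ by (auto simp: U_def)
    qed
    from ww(2) show "\<exists>a\<in>B w. \<exists>b\<in>B w'. (a, b) \<in> E"
    proof
      assume "w \<in> T \<and> w' \<in> T"
      then show ?thesis using Tcl ww(1) BT qself by blast
    next
      assume u: "w \<in> U \<and> w' \<in> U"
      then obtain z z' where z: "z \<in> B w" "z \<in> Z" "z' \<in> B w'" "z' \<in> Z" using U_end by blast
      have "B w \<inter> B w' = {}"
      proof -
        have "B a \<inter> B b = {}" if "a \<in> T" "b \<in> U" "a \<noteq> b" for a b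
        proof (cases "b \<in> T")
          case True
          then show ?thesis using BT qdisj that by simp
        next
          case False
          then have "b = r1 \<or> b = r2" using that by (auto simp: U_def U0_def)
          then show ?thesis using BT[OF that(1)] Br qr[OF that(1)] by auto
        qed
        note TU = this
        show ?thesis
        proof (cases "w \<in> T \<or> w' \<in> T")
          case True
          then show ?thesis using TU[of w w'] TU[of w' w] u ww(1) by blast
        next
          case False
          then show ?thesis using u ww(1) Br r by (auto simp: U_def U0_def)
        qed
      qed
      then have "z \<noteq> z'" using z by blast
      then show ?thesis using Zcl z by blast
    qed
  qed
  have sF: "sgraph W F" using UW by (auto simp: sgraph_def F_def sym_def irrefl_def)
  have "card F = 60"
  proof -
    have "T \<inter> U = U0" using rT by (auto simp: U_def U0_def)
    then have int: "T \<times> T \<inter> U \<times> U = U0 \<times> U0" by blast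
    have "card (T \<times> T) + card (U \<times> U) = card (T \<times> T \<union> U \<times> U) + card (U0 \<times> U0)"
      using card_Un_Int[of "T \<times> T" "U \<times> U"] cT(2) UW(4) int by simp
    \<comment> \<open>49 + 36 - 16 pairs; subtracting the 9 loops leaves 60 arcs.\<close>
    then have c69: "card (T \<times> T \<union> U \<times> U) = 69" using cT cU cU0 by (simp add: card_cartesian_product)
    have "F = (T \<times> T \<union> U \<times> U) - (\<lambda>x. (x, x)) ` W"
      by (auto simp: F_def W_def U_def U0_def)
    moreover have "(\<lambda>x. (x, x)) ` W \<subseteq> T \<times> T \<union> U \<times> U" by (auto simp: W_def U_def)
    moreover have "card ((\<lambda>x. (x, x)) ` W) = 9" using cW by (simp add: card_image inj_on_def)
    ultimately show ?thesis using c69 UW(3) by (simp add: card_Diff_subset)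
  qed
  with minor9_le[OF mF sF cW] show False by simp
qed

text \<open>The one vertex \<open>a\<close> beyond \<open>cnb x\<close> either sees only the middle,
  hence at most two further vertices of \<open>X\<close>, or has a neighbour \<open>y\<close> in
  \<open>X - Y\<close>. In the second case all triangles on \<open>ay\<close> stay inside
  \<open>X\<close>, which forces \<open>a\<close> to see all of \<open>nb x\<close>.\<close>

lemma separation_side8:
  assumes x: "x \<in> V" "card (nb x) = 6"
    and sep: "separation V E (cnb x) Z X Y" "card (X \<inter> Y) \<le> 3" "card X = 8" "Y - X \<noteq> {}"
  shows "\<exists>a. a \<in> X \<inter> Y \<and> a \<notin> cnb x \<and> X = insert a (cnb x) \<and> (card (nb a \<inter> cnb x) \<le> 2 \<or>
    nb a \<inter> cnb x = nb x \<and> (\<exists>y\<in>X - Y. (a, y) \<in> E))"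
proof -
  have XY: "X \<union> Y = V" "cnb x \<subseteq> X" "E \<inter> (X - Y) \<times> (Y - X) = {}"
    using sep(1) by (auto simp: separation_def)
  have finX: "finite X" "finite Y" using XY(1) by auto
  have "card (X - cnb x) = 1" using XY(2) x(2) sep(3) by (subst card_Diff_subset) auto
  then obtain a where a: "X - cnb x = {a}" by (auto simp: card_1_singleton_iff)
  then have Xa: "X = insert a (cnb x)" "a \<notin> cnb x" "a \<in> X" using XY(2) by auto
  have "a \<in> Y"
  \<comment> \<open>Otherwise \<open>a\<close> has no neighbour in \<open>Y - X\<close>, although
    these vertices and \<open>a\<close> together form the connected set
    \<open>V - cnb x\<close>.\<close>
  proof (rule ccontr)
    assume "a \<notin> Y"
    have "conn E (V - cnb x)" by (rule degree6_complement(1)[OF x])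
    moreover have "V - cnb x = insert a (Y - X)" using XY(1,2) Xa by auto
    ultimately have c: "conn E (insert a (Y - X))" by simp
    have "{a} \<noteq> insert a (Y - X)" using sep(4) Xa(3) by auto
    then obtain b where "b \<in> Y - X" "(a, b) \<in> E" using conn_cut[OF c, of "{a}"] by auto
    with XY(3) \<open>a \<notin> Y\<close> Xa(3) show False by blast
  qed
  have ax: "nb a \<inter> cnb x \<subseteq> nb x" using Xa(2) E_sym by auto
  have "card (nb a \<inter> cnb x) \<le> 2 \<or> nb a \<inter> cnb x = nb x \<and> (\<exists>y\<in>X - Y. (a, y) \<in> E)"
  proof (cases "\<exists>y\<in>X - Y. (a, y) \<in> E")
    case True
    then obtain y where y: "y \<in> X" "y \<notin> Y" "(a, y) \<in> E" by blast
    have "nb y \<subseteq> X"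
      using XY(1,3) y nb_subset[of "{y}"] by blast
    then have "insert y (nb a \<inter> nb y) \<subseteq> nb a \<inter> cnb x" using y Xa(1) by auto
    then have "card (insert y (nb a \<inter> nb y)) \<le> card (nb a \<inter> cnb x)" by (intro card_mono) auto
    moreover have "card (insert y (nb a \<inter> nb y)) = Suc (card (nb a \<inter> nb y))" by simp
    ultimately have "card (nb x) \<le> card (nb a \<inter> cnb x)" using edge_triangles[OF y(3)] x(2) by linarith
    then have "nb a \<inter> cnb x = nb x" using ax by (intro card_seteq) auto
    with True show ?thesis by blast
  next
    case False
    then have "nb a \<inter> cnb x \<subseteq> X \<inter> Y - {a}" using Xa by auto
    then have "card (nb a \<inter> cnb x) \<le> card (X \<inter> Y - {a})" using finX by (intro card_mono) auto
    also have "\<dots> \<le> 2" using sep(2) Xa(3) \<open>a \<in> Y\<close> finX by simp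
    finally show ?thesis by blast
  qed
  with Xa \<open>a \<in> Y\<close> show ?thesis by blast
qed

lemma separation_swap: "separation V E A B X Y \<Longrightarrow> separation V E B A Y X"
  unfolding separation_def using E_sym by blast

text \<open>If \<open>X\<close> were just \<open>cnb x\<close>, the at least 5 vertices of
  \<open>nb x\<close> with neighbours outside would all lie in the middle.\<close>

lemma separation_card7:
  assumes x: "x \<in> V" "card (nb x) = 6"
    and sep: "separation V E (cnb x) Z X Y" "card (X \<inter> Y) \<le> 3"
  shows "8 \<le> card X"
proof (rule ccontr)
  assume n: "\<not> 8 \<le> card X"
  have XY: "X \<union> Y = V" "cnb x \<subseteq> X" "E \<inter> (X - Y) \<times> (Y - X) = {}"
    using sep(1) by (auto simp: separation_def)
  have "finite X" "finite Y" using XY(1) by auto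
  then have "X = cnb x" using XY(2) n x(2) card_seteq[of X "cnb x"] by simp
  then have "E `` (V - cnb x) \<inter> nb x \<subseteq> X \<inter> Y"
    using XY E_sym by blast
  then have "card (E `` (V - cnb x) \<inter> nb x) \<le> card (X \<inter> Y)"
    using \<open>finite X\<close> by (intro card_mono) auto
  then show False using degree6_complement(2)[OF x] sep(2) by linarith
qed

text \<open>The arc count excludes order at most 3 outright when both sides have at least 9
  vertices. A side with 8 vertices is a K7 plus one vertex, whose adjacencies are known from
  \<open>separation_side8\<close>; these settle the other cases.\<close>

lemma degree6_separation:
  assumes x: "x \<in> V" "card (nb x) = 6" and v: "v \<in> V" "card (nb v) = 6"
    and sep: "separation V E (cnb x) (cnb v) X Y"
  shows "4 \<le> card (X \<inter> Y)"
proof (rule ccontr)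
  assume "\<not> 4 \<le> card (X \<inter> Y)"
  then have s3: "card (X \<inter> Y) \<le> 3" "card (Y \<inter> X) \<le> 3" by (simp_all add: Int_commute)
  have XY: "X \<union> Y = V" "cnb x \<subseteq> X" "cnb v \<subseteq> Y" "E \<inter> (X - Y) \<times> (Y - X) = {}"
    using sep by (auto simp: separation_def)
  have fin: "finite X" "finite Y" and sub: "X \<subseteq> V" "Y \<subseteq> V" using XY(1) by auto
  note sep' = separation_swap[OF sep]
  have c8: "8 \<le> card X" "8 \<le> card Y"
    using separation_card7[OF x sep s3(1)] separation_card7[OF v sep' s3(2)] .
  have ne: "X - Y \<noteq> {}" "Y - X \<noteq> {}"
  proof -
    show "X - Y \<noteq> {}"
    proof
      assume "X - Y = {}"
      then have "X \<inter> Y = X" by blast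
      then show False using c8 s3 by simp
    qed
    show "Y - X \<noteq> {}"
    proof
      assume "Y - X = {}"
      then have "X \<inter> Y = Y" by blast
      then show False using c8 s3 by simp
    qed
  qed
  have lt: "card X < card V" "card Y < card V"
    using ne sub by (auto intro!: psubset_card_mono finite_V)
  have e: "card E + ar (X \<inter> Y) = ar X + ar Y" by (rule ar_separation[OF XY(1,4)])
  have n: "card X + card Y = card V + card (X \<inter> Y)" using card_Un_Int[OF fin] XY(1) by simp
  have large: "ar A + 30 \<le> 10 * card A" if "A \<subseteq> V" "card A < card V" "8 \<le> card A" "card A \<noteq> 8" for A
    using ar_bound[OF that(1)] that by simp
  have mixed: False
    if sepA: "separation V E (cnb y) Q A B" and y: "y \<in> V" "card (nb y) = 6"
      and s3': "card (A \<inter> B) \<le> 3" and c: "card A = 8" "B - A \<noteq> {}"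
      and B: "ar B + 30 \<le> 10 * card B"
      and eq: "card E + ar (A \<inter> B) = ar A + ar B" "card A + card B = card V + card (A \<inter> B)"
    for A B y Q
  proof -
    obtain a where a: "a \<in> A \<inter> B" "a \<notin> cnb y" "A = insert a (cnb y)"
      "card (nb a \<inter> cnb y) \<le> 2 \<or> nb a \<inter> cnb y = nb y"
      using separation_side8[OF y sepA s3' c] by blast
    have arA: "ar A = 42 + 2 * card (nb a \<inter> cnb y)"
      unfolding a(3) using ar_insert[OF _ a(2)] ar_cnb6[OF y(2)] by simp
    \<comment> \<open>With s the order and t the number of neighbours of \<open>a\<close> in
      \<open>cnb y\<close>, the count gives
      \<open>40 + ar (A \<inter> B) \<le> 10 * s + 2 * t\<close>. As s is at most 3, only t = 6 and
      s = 3 survive, with at most one edge in the middle.\<close>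
    have "card (nb a \<inter> cnb y) = 6 \<and> nb a \<inter> cnb y = nb y \<and> card (A \<inter> B) = 3 \<and> ar (A \<inter> B) \<le> 2"
      using a(4)
    proof
      assume "card (nb a \<inter> cnb y) \<le> 2"
      then show ?thesis using arA eq B c(1) card_E s3' by linarith
    next
      assume "nb a \<inter> cnb y = nb y"
      moreover from this have "card (nb a \<inter> cnb y) = 6" using y(2) by simp
      ultimately show ?thesis using arA eq B c(1) card_E s3' by linarith
    qed
    then have h: "nb a \<inter> cnb y = nb y" "card (A \<inter> B) = 3" "ar (A \<inter> B) \<le> 2" by blast+
    have finAB: "finite (A \<inter> B)" using a(3) by simp
    have "card (A \<inter> B - {a}) = 2" using h(2) a(1) finAB by simp
    then obtain p q where pq: "A \<inter> B - {a} = {p, q}" "p \<noteq> q" by (auto simp: card_2_iff)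
    then have pq': "p \<in> cnb y" "q \<in> cnb y" "p \<in> A \<inter> B" "q \<in> A \<inter> B" using a(3) by blast+
    have "(p, q) \<in> E" using cnb6_clique[OF y(2) pq'(1,2) pq(2)] .
    \<comment> \<open>At most one of \<open>p\<close> and \<open>q\<close> is \<open>y\<close>, and
      \<open>a\<close> sees every other vertex of \<open>cnb y\<close>. The middle thus contains two
      edges.\<close>
    moreover have "(a, p) \<in> E \<or> (a, q) \<in> E" using h(1) pq' pq(2) by blast
    then obtain r where r: "r \<in> {p, q}" "(a, r) \<in> E" by blast
    ultimately have "{(p, q), (q, p), (a, r), (r, a)} \<subseteq> E \<inter> (A \<inter> B) \<times> (A \<inter> B)"
      using E_sym pq' a(1) by auto
    then have "card {(p, q), (q, p), (a, r), (r, a)} \<le> ar (A \<inter> B)"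
      unfolding ar_def using finAB by (intro card_mono) auto
    moreover have "a \<noteq> p" "a \<noteq> q" using pq by blast+
    then have "card {(p, q), (q, p), (a, r), (r, a)} = 4" using pq(2) r(1) by auto
    ultimately show False using h(3) by simp
  qed
  show False
  proof (cases "card X = 8")
    case False
    then have bX: "ar X + 30 \<le> 10 * card X" using large[OF sub(1) lt(1) c8(1)] by blast
    show False
    proof (cases "card Y = 8")
      case True
      show False
        by (rule mixed[OF sep' v s3(2) True ne(1) bX])
          (use e n in \<open>simp_all add: Int_commute\<close>)
    next
      case False
      then have "ar Y + 30 \<le> 10 * card Y" using large[OF sub(2) lt(2) c8(2)] by blast
      then show False using bX e n card_E s3(1) by linarith
    qed
  next
    case X8: True
    show False
    proof (cases "card Y = 8")
      case False
      then have bY: "ar Y + 30 \<le> 10 * card Y" using large[OF sub(2) lt(2) c8(2)] by blast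
      show False by (rule mixed[OF sep x s3(1) X8 ne(2) bY e n])
    next
      case Y8: True
      obtain a where a: "a \<in> X \<inter> Y" "a \<notin> cnb x" "X = insert a (cnb x)"
        "card (nb a \<inter> cnb x) \<le> 2 \<or> nb a \<inter> cnb x = nb x \<and> (\<exists>y\<in>X - Y. (a, y) \<in> E)"
        using separation_side8[OF x sep s3(1) X8 ne(2)] by blast
      obtain b where b: "b \<in> Y \<inter> X" "b \<notin> cnb v" "Y = insert b (cnb v)"
        "card (nb b \<inter> cnb v) \<le> 2 \<or> nb b \<inter> cnb v = nb v \<and> (\<exists>y\<in>Y - X. (b, y) \<in> E)"
        using separation_side8[OF v sep' s3(2) Y8 ne(1)] by blast
      have arX: "ar X = 42 + 2 * card (nb a \<inter> cnb x)"
        by (subst a(3)) (use ar_insert[OF _ a(2)] ar_cnb6[OF x(2)] in simp)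
      have arY: "ar Y = 42 + 2 * card (nb b \<inter> cnb v)"
        by (subst b(3)) (use ar_insert[OF _ b(2)] ar_cnb6[OF v(2)] in simp)
      have t6: "card (nb a \<inter> cnb x) \<le> 2 \<or> card (nb a \<inter> cnb x) = 6" using a(4) x(2) by auto
      have u6: "card (nb b \<inter> cnb v) \<le> 2 \<or> card (nb b \<inter> cnb v) = 6" using b(4) v(2) by auto
      have sum: "card E + ar (X \<inter> Y) = 84 + 2 * card (nb a \<inter> cnb x) + 2 * card (nb b \<inter> cnb v)"
        using e arX arY by simp
      \<comment> \<open>Here \<open>card V\<close> is 16 - s. With t and u neighbours of
        \<open>a\<close> and \<open>b\<close> in the two cliques, the count becomes
        \<open>48 + ar (X \<inter> Y) = 10 * s + 2 * t + 2 * u\<close>.\<close>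
      have "card (X \<inter> Y) = 3 \<and> card (nb a \<inter> cnb x) = 6 \<and> card (nb b \<inter> cnb v) = 6"
        using sum n card_E X8 Y8 s3 t6 u6 by presburger
      then have h: "card (X \<inter> Y) = 3" "card (nb a \<inter> cnb x) = 6" "card (nb b \<inter> cnb v) = 6" by auto
      obtain y where y: "y \<in> Y - X" "(b, y) \<in> E" using b(4) h(3) by auto
      have YX: "Y - X \<subseteq> cnb v" using b by blast
      have "conn E (Y - X)"
        by (rule conn_clique[OF ne(2)], rule cnb6_clique[OF v(2)]) (use YX in blast)+
      then have "ar X + 2 * card (E `` (Y - X) \<inter> X) \<le> 58"
        using attach_bound[OF sub(1) _ _ _ X8, of "Y - X"] sub(2) by blast
      \<comment> \<open>The clique \<open>Y - X\<close>, contracted to one vertex, sees the whole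
        middle: \<open>b\<close> through \<open>y\<close>, the other vertices through the K7. So
        \<open>X\<close> with its 54 arcs gains 6 more.\<close>
      moreover have "X \<inter> Y \<subseteq> E `` (Y - X) \<inter> X"
      proof
        fix s assume s: "s \<in> X \<inter> Y"
        then consider "s = b" | "s \<in> cnb v" using b(3) by blast
        then have "(y, s) \<in> E"
        proof cases
          case 1
          then show ?thesis using y E_sym by blast
        next
          case 2
          have "y \<noteq> s" using s y by blast
          then show ?thesis using cnb6_clique[OF v(2) _ 2] y YX by blast
        qed
        then show "s \<in> E `` (Y - X) \<inter> X" using y s by blast
      qed
      then have "card (X \<inter> Y) \<le> card (E `` (Y - X) \<inter> X)" by (intro card_mono) auto
      ultimately show False using h arX by simp
    qed
  qed
qed


text \<open>Non-adjacent vertices of degree 6 have at most three common neighbours. Menger's theorem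
  then supplies the four paths that \<open>no_linkage\<close> forbids.\<close>

lemma degree6_adjacent:
  assumes x: "x \<in> V" "card (nb x) = 6" and v: "v \<in> V" "card (nb v) = 6" and ne: "x \<noteq> v"
  shows "(x, v) \<in> E"
proof (rule ccontr)
  assume nE: "(x, v) \<notin> E"
  then have vE: "(v, x) \<notin> E" using E_sym by blast
  define J where "J = nb x \<inter> nb v"
  have J: "cnb x \<inter> cnb v = J" using ne nE vE by (auto simp: J_def)
  have "card J \<le> 6" using card_mono[of "nb x" J] x(2) by (simp add: J_def)
  have "card J \<noteq> 6"
  proof
    assume c6: "card J = 6"
    have "J = nb x" by (rule card_subset_eq) (use c6 x(2) in \<open>auto simp: J_def\<close>)
    moreover have "J = nb v" by (rule card_subset_eq) (use c6 v(2) in \<open>auto simp: J_def\<close>)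
    ultimately have eq: "nb v = nb x" by simp
    have "V - cnb x \<noteq> {v}"
    proof
      assume "V - cnb x = {v}"
      then have "V \<subseteq> insert v (cnb x)" by blast
      then have "card V \<le> card (insert v (cnb x))" by (intro card_mono) auto
      then show False using card_V x(2) by (simp add: card_insert_if split: if_splits)
    qed
    moreover have "v \<in> V - cnb x" using v(1) ne nE by auto
    \<comment> \<open>With equal neighbourhoods \<open>v\<close> would be isolated in the connected
      set \<open>V - cnb x\<close>, which has further vertices.\<close>
    ultimately obtain b where "b \<in> V - cnb x" "(v, b) \<in> E"
      using conn_cut[OF degree6_complement(1)[OF x], of "{v}"] by auto
    then show False using eq by blast
  qed
  then have J3: "card J \<le> 3"
    using common_nbs_degree6[OF x v ne nE] \<open>card J \<le> 6\<close> by (simp add: J_def)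
  \<comment> \<open>The common neighbours are removed before linking and returned as one-vertex
    paths, so that the linkage is guaranteed to cover the overlap of the two cliques.\<close>
  define V' where "V' = V - J"
  define E' where "E' = E \<inter> V' \<times> V'"
  have finJ: "finite J" by (simp add: J_def)
  have "\<exists>\<P>. card \<P> = 4 - card J \<and> linkage V' E' (cnb x - J) (cnb v - J) \<P>"
  proof (rule menger)
    show "sgraph V' E'" unfolding E'_def V'_def by (rule sgraph_Int[OF sgraph]) blast
    show "cnb x - J \<subseteq> V'" "cnb v - J \<subseteq> V'"
      using cnb_subset[OF x(1)] cnb_subset[OF v(1)] by (auto simp: V'_def)
    fix X Y assume s: "separation V' E' (cnb x - J) (cnb v - J) X Y"
    have JV: "J \<subseteq> V" "J \<subseteq> cnb x" "J \<subseteq> cnb v" using J cnb_subset[OF x(1)] by auto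
    have "separation V E (cnb x) (cnb v) (X \<union> J) (Y \<union> J)"
      unfolding separation_def
    proof (intro conjI)
      show "X \<union> J \<union> (Y \<union> J) = V" using s JV(1) unfolding separation_def V'_def by blast
      show "cnb x \<subseteq> X \<union> J" "cnb v \<subseteq> Y \<union> J" using s unfolding separation_def by blast+
      show "E \<inter> (X \<union> J - (Y \<union> J)) \<times> (Y \<union> J - (X \<union> J)) = {}"
        using s unfolding separation_def V'_def E'_def by blast
    qed
    then have "4 \<le> card ((X \<union> J) \<inter> (Y \<union> J))" by (rule degree6_separation[OF x v])
    also have "(X \<union> J) \<inter> (Y \<union> J) = (X \<inter> Y) \<union> J" by blast
    also have "card ((X \<inter> Y) \<union> J) \<le> card (X \<inter> Y) + card J" by (rule card_Un_le)
    finally show "4 - card J \<le> card (X \<inter> Y)" by simp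
  qed
  then obtain \<P> where \<P>: "card \<P> = 4 - card J" "linkage V' E' (cnb x - J) (cnb v - J) \<P>" by blast
  define \<Q> where "\<Q> = \<P> \<union> (\<lambda>j. {j}) ` J"
  have PV: "P \<subseteq> V - J" if "P \<in> \<P>" for P using linkageD(1)[OF \<P>(2) that] by (simp add: V'_def)
  \<comment> \<open>Since \<open>card J\<close> is at most 3, the cardinality of \<open>\<P>\<close>
    is positive; as infinite sets have cardinality 0, this yields finiteness.\<close>
  have "finite \<P>" using \<P>(1) J3 by (intro card_ge_0_finite) simp
  moreover have "\<P> \<inter> (\<lambda>j. {j}) ` J = {}" using PV by blast
  ultimately have "card \<Q> = 4 - card J + card J"
    unfolding \<Q>_def using finJ \<P>(1) by (subst card_Un_disjoint) (auto simp: card_image)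
  then have c4: "card \<Q> = 4" using J3 by simp
  have "linkage V E (cnb x) (cnb v) \<Q>"
    unfolding linkage_def
  proof (intro conjI ballI impI)
    fix P assume "P \<in> \<Q>"
    then consider "P \<in> \<P>" | j where "j \<in> J" "P = {j}" by (auto simp: \<Q>_def)
    then have "P \<subseteq> V \<and> conn E P \<and> (\<exists>a. P \<inter> cnb x = {a}) \<and> (\<exists>b. P \<inter> cnb v = {b})"
    proof cases
      case 1
      have "P \<inter> cnb x = P \<inter> (cnb x - J)" "P \<inter> cnb v = P \<inter> (cnb v - J)" using PV[OF 1] by blast+
      moreover have "conn E P"
        by (rule conn_mono[OF linkageD(2)[OF \<P>(2) 1]]) (auto simp: E'_def)
      ultimately show ?thesis using linkageD(3,4)[OF \<P>(2) 1] PV[OF 1] by auto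
    next
      case 2
      then have "P \<inter> cnb x = {j}" "P \<inter> cnb v = {j}" "j \<in> V"
        using nb_subset[of "{x}"] by (auto simp: J_def)
      then show ?thesis using 2(2) by simp
    qed
    then show "P \<subseteq> V" "conn E P" "\<exists>a. P \<inter> cnb x = {a}" "\<exists>b. P \<inter> cnb v = {b}" by blast+
  next
    fix P Q assume "P \<in> \<Q>" "Q \<in> \<Q>" "P \<noteq> Q"
    then consider "P \<in> \<P>" "Q \<in> \<P>" | j where "P \<in> \<P>" "j \<in> J" "Q = {j}"
      | j where "Q \<in> \<P>" "j \<in> J" "P = {j}" | i j where "P = {i}" "Q = {j}" by (auto simp: \<Q>_def)
    then show "P \<inter> Q = {}"
    proof cases
      case 1
      then show ?thesis using linkageD(5)[OF \<P>(2)] \<open>P \<noteq> Q\<close> by blast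
    qed (use PV \<open>P \<noteq> Q\<close> in auto)
  qed
  moreover have "cnb x \<inter> cnb v \<subseteq> \<Union>\<Q>" unfolding J \<Q>_def by blast
  ultimately show False using no_linkage[OF x(2,1) v(2,1)] c4 by blast
qed

subsection \<open>The final contradiction\<close>

text \<open>Vertices of degree 6 are kept out of \<open>K\<close> so that a vertex of least degree
  in \<open>K\<close> has degree at least 7, where full components are contradictory.\<close>

definition eligible :: "'a \<Rightarrow> 'a set \<Rightarrow> bool" where
  "eligible x K \<longleftrightarrow> x \<in> V \<and> card (nb x) \<le> 9 \<and> component E (V - cnb x) K \<and> (\<forall>k\<in>K. card (nb k) \<noteq> 6)"

lemma degree_sum: "(\<Sum>x\<in>V. card (nb x)) = card E"
proof -
  have "ar V = card E" unfolding ar_def using E_subset by (simp add: Int_absorb2)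
  moreover have "nb x \<inter> V = nb x" for x using nb_subset[of "{x}"] by blast
  ultimately show ?thesis using ar_sum[OF finite_V] by simp
qed

text \<open>If \<open>v\<close> has degree 6, every other such vertex is adjacent to
  \<open>v\<close>, so the connected set \<open>V - cnb v\<close> contains none. Without such
  vertices, any component beyond a vertex of least degree serves, as the average degree is below
  10.\<close>

lemma eligible_exists: "\<exists>x K. eligible x K"
proof (cases "\<exists>v\<in>V. card (nb v) = 6")
  case True
  then obtain v where v: "v \<in> V" "card (nb v) = 6" by blast
  have "component E (V - cnb v) (V - cnb v)"
    using degree6_complement(1)[OF v] by (auto simp: component_def)
  moreover have "card (nb k) \<noteq> 6" if "k \<in> V - cnb v" for k
    using degree6_adjacent[OF v, of k] that by blast
  ultimately have "eligible v (V - cnb v)" using v unfolding eligible_def by simp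
  then show ?thesis by blast
next
  case False
  define m where "m = Min ((\<lambda>x. card (nb x)) ` V)"
  have V0: "V \<noteq> {}" using card_V by auto
  then have "m \<in> (\<lambda>x. card (nb x)) ` V" unfolding m_def using finite_V by (intro Min_in) auto
  then obtain x where x: "x \<in> V" "card (nb x) = m" by auto
  have "m \<le> card (nb y)" if "y \<in> V" for y unfolding m_def using that finite_V by (intro Min_le) auto
  then have sum: "m * card V \<le> card E"
    using sum_bounded_below[of V m "\<lambda>x. card (nb x)"] degree_sum by (simp add: mult.commute)
  have m9: "m \<le> 9"
  proof (rule ccontr)
    assume "\<not> m \<le> 9"
    then have "10 * card V \<le> m * card V" by (intro mult_right_mono) auto
    then show False using sum card_E by linarith
  qed
  have "V - cnb x \<noteq> {}"
  proof
    assume "V - cnb x = {}"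
    then have "card V \<le> card (cnb x)" by (intro card_mono) auto
    \<comment> \<open>A vertex seeing all others would make the least degree 9 on 10 vertices,
      needing 90 arcs where there are 72.\<close>
    then have "card V = 10" "m = 9" using m9 x(2) card_V by auto
    then show False using sum card_E by simp
  qed
  then obtain y where "y \<in> V - cnb x" by blast
  then obtain K where K: "component E (V - cnb x) K" by (meson component_exists sym_E)
  then have "\<forall>k\<in>K. card (nb k) \<noteq> 6" using False by (auto simp: component_def)
  then have "eligible x K" using x m9 K unfolding eligible_def by simp
  then show ?thesis by blast
qed

text \<open>Take \<open>(x, K)\<close> eligible with \<open>K\<close> smallest and \<open>w \<in> K\<close> of least degree. By minimality every
  neighbour of \<open>w\<close> with a neighbour outside \<open>cnb w\<close> is attached to the component containing \<open>x\<close>.\<close>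

lemma no_min_counterexample: False
proof -
  obtain x K where el: "eligible x K" and min: "\<And>x' K'. eligible x' K' \<Longrightarrow> card K \<le> card K'"
  proof -
    obtain p where "eligible (fst p) (snd p)" using eligible_exists by auto
    from ex_has_least_nat[of "\<lambda>p. eligible (fst p) (snd p)", OF this, of "\<lambda>p. card (snd p)"]
    show ?thesis using that by fastforce
  qed
  have x: "x \<in> V" "card (nb x) \<le> 9" and K: "component E (V - cnb x) K"
    and K6: "\<And>k. k \<in> K \<Longrightarrow> card (nb k) \<noteq> 6" using el by (auto simp: eligible_def)
  have KV: "K \<subseteq> V" "K \<inter> cnb x = {}" "conn E K" using K by (auto simp: component_def)
  then have K_fin: "finite K" "K \<noteq> {}" using conn_nonempty by simp_all
  have EK: "z \<in> K \<or> z \<in> nb x" if "k \<in> K" "(k, z) \<in> E" for k z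
    using that component_sep(4)[OF x(1) K HOL.refl] by blast
  define m where "m = Min ((\<lambda>k. card (nb k)) ` K)"
  have "m \<in> (\<lambda>k. card (nb k)) ` K" unfolding m_def using K_fin by (intro Min_in) auto
  then obtain w where w: "w \<in> K" "card (nb w) = m" by auto
  have m: "m \<le> card (nb k)" if "k \<in> K" for k unfolding m_def using that K_fin by (intro Min_le) auto
  obtain k where "k \<in> K" "card (nb k) \<le> 9" using component_small_degree[OF x K] by blast
  then have w9: "card (nb w) \<le> 9" using m w(2) by fastforce
  have wV: "w \<in> V" using w KV by blast
  have "7 \<le> card (nb w)" using min_degree[OF wV] K6[OF w(1)] by linarith
  have xw: "x \<in> V - cnb w" using x(1) w(1) KV(2) E_sym by blast
  then obtain C where C: "component E (V - cnb w) C" "x \<in> C" by (meson component_exists sym_E)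
  have "full_component w C"
    unfolding full_component_def
  proof (intro conjI ballI impI)
    show "component E (V - cnb w) C" by fact
    fix y z assume yz: "y \<in> nb w" "z \<in> nb w" "y \<noteq> z" "(y, z) \<notin> E"
    show "y \<in> E `` C"
    proof (cases "y \<in> nb x")
      case True
      then show ?thesis using C(2) by blast
    next
      case False
      then have yK: "y \<in> K" using EK[OF w(1)] yz(1) by blast
      \<comment> \<open>Least degree is used here: inclusion would force equality, and then
        \<open>y\<close> would see \<open>z\<close>.\<close>
      have "\<not> cnb y \<subseteq> cnb w"
      proof
        assume sub: "cnb y \<subseteq> cnb w"
        have "card (cnb w) \<le> card (cnb y)" using m[OF yK] w(2) by simp
        then have "cnb y = cnb w" using sub by (intro card_seteq) auto
        moreover have "z \<in> cnb w" using yz(2) by blast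
        ultimately have "z \<in> cnb y" by (simp only:)
        then show False using yz(3,4) by blast
      qed
      then obtain u where u: "(y, u) \<in> E" "u \<notin> cnb w" using yz(1) by blast
      then have uV: "u \<in> V - cnb w" using E_subset by blast
      show ?thesis
      proof (cases "u \<in> C")
        case True
        then show ?thesis using u(1) E_sym by blast
      next
        case False
        obtain C' where C': "component E (V - cnb w) C'" "u \<in> C'"
          using uV by (meson component_exists sym_E)
        have inC: "z \<in> C" if "z \<in> V - cnb w" "z \<in> cnb x" for z
          using that C unfolding component_def by blast
        have C'C: "C' \<inter> C = {}"
        proof (rule ccontr)
          assume "C' \<inter> C \<noteq> {}"
          then have "C' \<subseteq> C" using component_absorbs[OF C(1)] C'(1) by (auto simp: component_def)
          then show False using C'(2) False by blast
        qed
        \<comment> \<open>Every vertex of \<open>cnb x\<close> outside \<open>cnb w\<close> belongs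
          to \<open>C\<close>. Another component thus avoids \<open>cnb x\<close>, falls into
          \<open>K\<close>, and misses \<open>w\<close>, contradicting the minimality of
          \<open>K\<close>.\<close>
        have C'sub: "C' \<subseteq> V - cnb x" using inC C'C C'(1) by (auto simp: component_def)
        have "u \<in> K" using EK[OF yK u(1)] C'sub C'(2) by blast
        then have "C' \<subseteq> K"
          using component_absorbs[OF K _ C'sub] C' by (auto simp: component_def)
        moreover have "w \<notin> C'" using C'(1) by (auto simp: component_def)
        ultimately have "C' \<subset> K" using w(1) by blast
        then have "card C' < card K" using K_fin(1) by (intro psubset_card_mono)
        moreover have "eligible w C'"
          using wV w9 C'(1) \<open>C' \<subset> K\<close> K6 by (auto simp: eligible_def)
        ultimately show ?thesis using min by fastforce
      qed
    qed
  qed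
  then show False using no_full_component[OF wV \<open>7 \<le> card (nb w)\<close> w9] by blast
qed

end

text \<open>Strong induction on the number of vertices supplies \<open>minor_le\<close>: a smaller
  minor exceeding that bound would itself be good. On 9 vertices the edge bound is already
  30.\<close>

theorem good_of_card:
  assumes "sgraph V E" "9 \<le> card V" "10 * card V \<le> card E + 28"
  shows "good V E"
  using assms
proof (induction "card V" arbitrary: V E rule: less_induct)
  case less
  show ?case
  proof (cases "card V = 9")
    case True
    then have "60 \<le> card E" using less.prems(3) by simp
    then show ?thesis
      unfolding good_def using less.prems(1) True minor_sub[of V V E E] by blast
  next
    case False
    show ?thesis
    proof (rule ccontr)
      assume bad: "\<not> good V E"
      have "2 * (5 * card V - 14) \<le> card E" using less.prems(3) by simp
      \<comment> \<open>Trimming to exactly 5n - 14 edges makes \<open>card_E\<close> an equation,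
        as the counts across separations require.\<close>
      then obtain F where F: "F \<subseteq> E" "sgraph V F" "card F = 2 * (5 * card V - 14)"
        using sgraph_subset_card[OF less.prems(1)] by blast
      have VF: "minor V E V F" by (rule minor_sub) (use F(1) in auto)
      interpret min_counterexample V F
      proof
        show "sgraph V F" by fact
        show "10 \<le> card V" using less.prems(2) False by simp
        then show "card F + 28 = 10 * card V" using F(3) by simp
        show "\<not> good V F" using bad good_minor[OF VF] by blast
        fix W H assume W: "minor V F W H" "sgraph W H" "9 \<le> card W" "card W < card V"
        show "card H + 30 \<le> 10 * card W"
        proof (rule ccontr)
          assume "\<not> card H + 30 \<le> 10 * card W"
          \<comment> \<open>The negation only gives more than \<open>10 * card W - 30\<close> arcs;
            evenness raises this to the induction threshold.\<close>
          then have "10 * card W \<le> card H + 28" using sgraph_card_even[OF W(2)] by presburger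
          then have "good W H" using less.hyps W by blast
          then show False using bad good_minor[OF VF] good_minor[OF W(1)] by blast
        qed
      qed
      show False by (rule no_min_counterexample)
    qed
  qed
qed

theorem theorem1p5:
  fixes G :: "'a pair_pre_digraph" and n :: nat
  assumes "pair_graph G"
    and "card (pverts G) = n"
    and "n \<ge> 9"
    and "card (uedges G) \<ge> 5 * n - 14"
  shows "has_K_minus_minor G 9 6"
proof (rule good_imp_has_K_minus_minor[OF assms(1)], rule good_of_card)
  show "sgraph (pverts G) (parcs G)" using assms(1) by (simp add: pair_graph_sgraph)
  show "9 \<le> card (pverts G)" "10 * card (pverts G) \<le> card (parcs G) + 28"
    using assms card_parcs_eq_twice_card_uedges[OF assms(1)] by simp_all
qed

end
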